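(* Let $R=\bigoplus_{\alpha\in\Gamma}R_{\alpha}$ be a graded integral domain. Then the following are equivalent: (1) $R$ is integrally closed; (2) $(A_fA_g)^v=A_{fg}^v$ for all $f,g\in R[X]\setminus\{0\}$; (3) there is a (semi)star operation $\star$ on $R$ such that $(A_fA_g)^{\star}=A_{fg}^{\star}$ for all nonzero $f,g\in R_H[X]$ with $f$ linear; (4) $fR_H[X]\cap R[X]=f(R:A_f)R[X]$ for all nonzero $f\in R[X]$.
   Context: $\Gamma$ is a commutative cancellative monoid (written additively) whose quotient group $\langle\Gamma\rangle$ is torsion-free. A graded integral domain $R=\bigoplus_{\alpha\in\Gamma}R_\alpha$ is an integral domain that is the direct sum of additive subgroups $R_\alpha$ with $R_\alpha R_\beta\subseteq R_{\alpha+\beta}$. $K$ is its quotient field, $H$ the set of nonzero homogeneous elements, $R_H$ the homogeneous quotient field. For $a\in R_H$, $C(a)$ is the $R$-submodule of $R_H$ generated by the homogeneous components of $a$; for $f=f_0+\cdots+f_nX^n\in R_H[X]$, $A_f:=\sum_i C(f_i)$. $(R:E)=\{x\in K: xE\subseteq R\}$ and $E^v=(R:(R:E))$. A semistar operation on $R$ is a map $\star$ from the set of nonzero $R$-submodules of $K$ to itself such that for all $0\ne x\in K$ and $E,F$: $(xE)^\star=xE^\star$; $E\subseteq F\Rightarrow E^\star\subseteq F^\star$; $E\subseteq E^\star$; $(E^\star)^\star=E^\star$; it is a (semi)star operation if moreover $R^\star=R$. "Linear" means of degree one in $X$. *)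

theory Defs
  imports "HOL-Computational_Algebra.Polynomial"
begin

text \<open>The grading monoid Gamma is the whole carrier of a type of class
 cancel_comm_monoid_add (commutative, cancellative).  Its quotient group is
 torsion-free iff n a = n b with n >= 1 forces a = b.\<close>

definition torsion_free_quotient :: "'g::cancel_comm_monoid_add itself \<Rightarrow> bool" where
  "torsion_free_quotient _ \<longleftrightarrow>
     (\<forall>(n::nat) (a::'g) b. n > 0 \<longrightarrow> (\<Sum>i<n. a) = (\<Sum>i<n. b) \<longrightarrow> a = b)"

definition graded_domain :: "'k::field set \<Rightarrow> ('g::cancel_comm_monoid_add \<Rightarrow> 'k set) \<Rightarrow> bool" where
  "graded_domain R Rg \<longleftrightarrow>
     0 \<in> R \<and> 1 \<in> R \<and>
     (\<forall>a\<in>R. \<forall>b\<in>R. a + b \<in> R \<and> a - b \<in> R \<and> a * b \<in> R) \<and>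
     (\<forall>x::'k. \<exists>a\<in>R. \<exists>b\<in>R. b \<noteq> 0 \<and> x = a / b) \<and>
     (\<forall>\<alpha>. 0 \<in> Rg \<alpha> \<and> Rg \<alpha> \<subseteq> R \<and> (\<forall>a\<in>Rg \<alpha>. \<forall>b\<in>Rg \<alpha>. a - b \<in> Rg \<alpha>)) \<and>
     (\<forall>\<alpha> \<beta>. \<forall>a\<in>Rg \<alpha>. \<forall>b\<in>Rg \<beta>. a * b \<in> Rg (\<alpha> + \<beta>)) \<and>
     (\<forall>r\<in>R. \<exists>!c. finite {\<alpha>. c \<alpha> \<noteq> 0} \<and> (\<forall>\<alpha>. c \<alpha> \<in> Rg \<alpha>) \<and>
                   r = sum c {\<alpha>. c \<alpha> \<noteq> 0})"

definition comp :: "('g::cancel_comm_monoid_add \<Rightarrow> 'k::field set) \<Rightarrow> 'k \<Rightarrow> 'g \<Rightarrow> 'k" where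
  "comp Rg r = (THE c. finite {\<alpha>. c \<alpha> \<noteq> 0} \<and> (\<forall>\<alpha>. c \<alpha> \<in> Rg \<alpha>) \<and>
                   r = sum c {\<alpha>. c \<alpha> \<noteq> 0})"

definition homog :: "('g \<Rightarrow> 'k::field set) \<Rightarrow> 'k set" where
  "homog Rg = {x. x \<noteq> 0 \<and> (\<exists>\<alpha>. x \<in> Rg \<alpha>)}"

definition RH :: "'k::field set \<Rightarrow> ('g \<Rightarrow> 'k set) \<Rightarrow> 'k set" where
  "RH R Rg = {a / h | a h. a \<in> R \<and> h \<in> homog Rg}"

text \<open>Homogeneous components of a = r/h in R_H are the r_alpha / h
  (independent of the chosen representation).\<close>
definition compsH :: "'k::field set \<Rightarrow> ('g::cancel_comm_monoid_add \<Rightarrow> 'k set) \<Rightarrow> 'k \<Rightarrow> 'k set" where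
  "compsH R Rg a = {comp Rg r \<alpha> / h | r h \<alpha>. r \<in> R \<and> h \<in> homog Rg \<and> a = r / h}"

definition rmod :: "'k::field set \<Rightarrow> 'k set \<Rightarrow> 'k set" where
  "rmod R S = {x. \<exists>F c. finite F \<and> F \<subseteq> S \<and> (\<forall>s\<in>F. c s \<in> R) \<and> x = (\<Sum>s\<in>F. c s * s)}"

definition Cont :: "'k::field set \<Rightarrow> ('g::cancel_comm_monoid_add \<Rightarrow> 'k set) \<Rightarrow> 'k \<Rightarrow> 'k set" where
  "Cont R Rg a = rmod R (compsH R Rg a)"

text \<open>A_f = sum of C(f_i) = submodule generated by all homogeneous components
  of all coefficients of f.\<close>
definition Af :: "'k::field set \<Rightarrow> ('g::cancel_comm_monoid_add \<Rightarrow> 'k set) \<Rightarrow> 'k poly \<Rightarrow> 'k set" where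
  "Af R Rg f = rmod R (\<Union>i\<le>degree f. compsH R Rg (coeff f i))"

definition mprod :: "'k::field set \<Rightarrow> 'k set \<Rightarrow> 'k set \<Rightarrow> 'k set" where
  "mprod R E F = rmod R {a * b | a b. a \<in> E \<and> b \<in> F}"

definition colon :: "'k::field set \<Rightarrow> 'k set \<Rightarrow> 'k set" where
  "colon R E = {x. \<forall>e\<in>E. x * e \<in> R}"

definition vclos :: "'k::field set \<Rightarrow> 'k set \<Rightarrow> 'k set" where
  "vclos R E = colon R (colon R E)"

definition polys_over :: "'k::field set \<Rightarrow> 'k poly set" where
  "polys_over S = {p. \<forall>i. coeff p i \<in> S}"

definition ext_mod :: "'k::field set \<Rightarrow> 'k set \<Rightarrow> 'k poly set" where
  "ext_mod R I = {p. \<exists>(n::nat) c g. (\<forall>i<n. c i \<in> I \<and> g i \<in> polys_over R) \<and>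
                        p = (\<Sum>i<n. smult (c i) (g i))}"

definition integrally_closed :: "'k::field set \<Rightarrow> bool" where
  "integrally_closed R \<longleftrightarrow>
     (\<forall>x::'k. (\<exists>p. lead_coeff p = 1 \<and> (\<forall>i. coeff p i \<in> R) \<and> poly p x = 0) \<longrightarrow> x \<in> R)"

definition nz_submod :: "'k::field set \<Rightarrow> 'k set \<Rightarrow> bool" where
  "nz_submod R E \<longleftrightarrow> 0 \<in> E \<and> (\<forall>a\<in>E. \<forall>b\<in>E. a + b \<in> E) \<and>
     (\<forall>r\<in>R. \<forall>a\<in>E. r * a \<in> E) \<and> E \<noteq> {0}"

definition semistar :: "'k::field set \<Rightarrow> ('k set \<Rightarrow> 'k set) \<Rightarrow> bool" where
  "semistar R st \<longleftrightarrow>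
     (\<forall>E. nz_submod R E \<longrightarrow> nz_submod R (st E)) \<and>
     (\<forall>E x. nz_submod R E \<longrightarrow> x \<noteq> 0 \<longrightarrow> st ((*) x ` E) = (*) x ` st E) \<and>
     (\<forall>E F. nz_submod R E \<longrightarrow> nz_submod R F \<longrightarrow> E \<subseteq> F \<longrightarrow> st E \<subseteq> st F) \<and>
     (\<forall>E. nz_submod R E \<longrightarrow> E \<subseteq> st E) \<and>
     (\<forall>E. nz_submod R E \<longrightarrow> st (st E) = st E)"

definition semi_star :: "'k::field set \<Rightarrow> ('k set \<Rightarrow> 'k set) \<Rightarrow> bool" where
  "semi_star R st \<longleftrightarrow> semistar R st \<and> st R = R"

end

theory Submission
  imports Defs "HOL-Library.Product_Plus"
begin

text \<open>Two facts carry the equivalences.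

  First, if \<open>R\<close> is integrally closed then \<open>(R : A\<^sub>f A\<^sub>g) = (R : A\<^sub>f\<^sub>g)\<close>. The components of the coefficients
  of \<open>f\<close> and \<open>g\<close> are two families indexed by the torsion-free monoid \<open>\<Gamma> \<times> \<nat>\<close>, and those of \<open>f g\<close> are their
  convolution; the claim is a generalized Gauss--Prufer theorem. It is checked at every valuation ring above
  \<open>R\<close>, using a total order on the index monoid to find a coefficient of the product without cancellation.

  Secondly, every element \<open>x\<close> of \<open>K\<close> integral over \<open>R\<close> lies in \<open>R\<^sub>H\<close>. The finitely many homogeneous elements
  involved generate, modulo the units of degree zero, a free abelian group, so everything takes place in an
  iterated Laurent polynomial ring over a field, and such a ring is completely integrally closed.
  If \<open>p\<close> is a monic equation for \<open>x\<close> over \<open>R\<close>, then \<open>p = (X - x) g\<close> over \<open>R\<^sub>H\<close> with \<open>A\<^sub>p = R\<close>, and both (3) and (4),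
  applied to a multiple of the linear factor, give \<open>x \<in> R\<close>.\<close>

text \<open>Why membership in R_H is the hard point: an integral element is a quotient a / b of
  arbitrary elements of R, and its equation does not show that a homogeneous denominator suffices.
  As long as this is open, X - x is not known to be a polynomial over R_H, and neither (3) nor (4)
  applies to it.

  Complete integral closure is used instead of integral closure because it passes from a ring to its
  Laurent ring by comparing leading coefficients, and because b ^ n is a common denominator of all
  powers of an integral a / b.

  A basis is available only for finitely generated groups of degrees, since a torsion-free abelian
  group need not be free; this forces the restriction to the components of a, b and the equation.
  The basis consists of homogeneous elements of K and not of degrees, so no multiplicative choice of
  representatives is required, and "equal degree" is expressed by "quotient in
  \<open>units0\<close>".

  All rings are subsets of the one field K, hence are compared by inclusion. Equality of v-closures
  is always treated as equality of the modules (R : E).\<close>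

definition is_subring :: "'a::comm_ring_1 set \<Rightarrow> bool" where
  "is_subring A \<longleftrightarrow> 0 \<in> A \<and> 1 \<in> A \<and> (\<forall>a\<in>A. \<forall>b\<in>A. a + b \<in> A \<and> a - b \<in> A \<and> a * b \<in> A)"

lemma
  assumes "is_subring A"
  shows subring_0: "0 \<in> A" and subring_1: "1 \<in> A"
    and subring_add: "a \<in> A \<Longrightarrow> b \<in> A \<Longrightarrow> a + b \<in> A"
    and subring_diff: "a \<in> A \<Longrightarrow> b \<in> A \<Longrightarrow> a - b \<in> A"
    and subring_mult: "a \<in> A \<Longrightarrow> b \<in> A \<Longrightarrow> a * b \<in> A"
  using assms unfolding is_subring_def by auto

lemma subring_uminus: "is_subring A \<Longrightarrow> a \<in> A \<Longrightarrow> - a \<in> A"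
  using subring_diff[of A 0 a] subring_0[of A] by simp

lemma subring_power: "is_subring A \<Longrightarrow> a \<in> A \<Longrightarrow> a ^ n \<in> A"
  by (induction n) (auto simp: subring_1 subring_mult)

lemma subring_sum: "is_subring A \<Longrightarrow> (\<And>i. i \<in> I \<Longrightarrow> f i \<in> A) \<Longrightarrow> sum f I \<in> A"
  by (induction I rule: infinite_finite_induct) (auto simp: subring_0 subring_add)

lemma subring_of_nat: "is_subring A \<Longrightarrow> of_nat n \<in> A"
  by (induction n) (auto simp: subring_0 subring_1 subring_add)

lemmas subring_intros = subring_0 subring_1 subring_add subring_diff subring_mult
  subring_uminus subring_power subring_sum subring_of_nat

lemma is_subring_polys_over:
  assumes "is_subring (A :: 'k::field set)"
  shows "is_subring (polys_over A)"
  unfolding is_subring_def[of "polys_over A"]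
  using assms by (auto simp: polys_over_def coeff_mult coeff_1 of_bool_def intro!: subring_intros)

lemma polys_over_mono: "A \<subseteq> B \<Longrightarrow> polys_over A \<subseteq> polys_over B"
  by (auto simp: polys_over_def)

lemma monom_in_polys_over: "is_subring A \<Longrightarrow> c \<in> A \<Longrightarrow> monom c n \<in> polys_over A"
  by (auto simp: polys_over_def subring_0)

lemma smult_in_polys_over: "is_subring A \<Longrightarrow> c \<in> A \<Longrightarrow> p \<in> polys_over A \<Longrightarrow> smult c p \<in> polys_over A"
  by (auto simp: polys_over_def subring_mult)

lemma coeff_in: "p \<in> polys_over A \<Longrightarrow> coeff p i \<in> A"
  by (simp add: polys_over_def)

lemma poly_in_subring: "is_subring A \<Longrightarrow> p \<in> polys_over A \<Longrightarrow> z \<in> A \<Longrightarrow> poly p z \<in> A"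
  unfolding poly_altdef by (intro subring_intros) (auto simp: coeff_in)

definition adjoin :: "'k::field set \<Rightarrow> 'k \<Rightarrow> 'k set" where
  "adjoin A z = (\<lambda>p. poly p z) ` polys_over A"

lemma is_subring_adjoin:
  assumes "is_subring A"
  shows "is_subring (adjoin A z)"
proof -
  note P = is_subring_polys_over[OF assms]
  show ?thesis
    unfolding is_subring_def adjoin_def
  proof (intro conjI ballI)
    show "0 \<in> (\<lambda>p. poly p z) ` polys_over A" "1 \<in> (\<lambda>p. poly p z) ` polys_over A"
      using subring_0[OF P] subring_1[OF P] by (force simp: image_iff)+
    fix a b assume "a \<in> (\<lambda>p. poly p z) ` polys_over A" "b \<in> (\<lambda>p. poly p z) ` polys_over A"
    then obtain p q where pq: "p \<in> polys_over A" "q \<in> polys_over A" "a = poly p z" "b = poly q z"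
      by blast
    have "p + q \<in> polys_over A" "p - q \<in> polys_over A" "p * q \<in> polys_over A"
      using pq subring_intros(3,4,5)[OF P] by auto
    then show "a + b \<in> (\<lambda>p. poly p z) ` polys_over A" "a - b \<in> (\<lambda>p. poly p z) ` polys_over A"
      "a * b \<in> (\<lambda>p. poly p z) ` polys_over A"
      by (force simp: pq)+
  qed
qed

lemma adjoin_incl: "is_subring A \<Longrightarrow> A \<subseteq> adjoin A z"
  unfolding adjoin_def image_def using monom_in_polys_over[of A _ 0]
  by (auto simp: poly_monom intro!: bexI[where x = "monom _ 0"])

lemma adjoin_self: "is_subring A \<Longrightarrow> z \<in> adjoin A z"
  unfolding adjoin_def image_def using monom_in_polys_over[of A 1 1]
  by (auto simp: poly_monom subring_1 intro!: bexI[where x = "monom 1 1"])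

section \<open>Valuation rings that avoid a given element\<close>

definition is_valuation_ring :: "'k::field set \<Rightarrow> bool" where
  "is_valuation_ring V \<longleftrightarrow> is_subring V \<and> (\<forall>z. z \<in> V \<or> inverse z \<in> V)"

lemma adjoin_inverse_not_mem:
  fixes R :: "'k::field set"
  assumes R: "is_subring R" and ic: "integrally_closed R" and y: "y \<notin> R"
  shows "y \<notin> adjoin R (inverse y)"
proof
  assume "y \<in> adjoin R (inverse y)"
  then obtain p where p: "p \<in> polys_over R" "y = poly p (inverse y)"
    by (auto simp: adjoin_def)
  have y0: "y \<noteq> 0" using y R by (auto simp: subring_0)
  define n where "n = degree p"
  \<comment> \<open>Multiplying \<open>y = poly p (inverse y)\<close> by \<open>y ^ n\<close> gives
    an equation with \<open>y ^ Suc n\<close> on one side and powers up to \<open>n\<close> on the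
    other, so \<open>q\<close> is monic.\<close>
  define q where "q = monom 1 (Suc n) - (\<Sum>i\<le>n. monom (coeff p i) (n - i))"
  have q: "q \<in> polys_over R"
    unfolding q_def using R p
    by (intro subring_intros is_subring_polys_over monom_in_polys_over) (auto simp: coeff_in)
  have s: "coeff (\<Sum>i\<le>n. monom (coeff p i) (n - i)) k = 0" if "k > n" for k
    using that by (auto simp: coeff_sum intro!: sum.neutral)
  have "degree (\<Sum>i\<le>n. monom (coeff p i) (n - i)) \<le> n"
    by (rule degree_le) (use s in auto)
  then have "degree q = Suc n"
    unfolding q_def
    by (subst diff_conv_add_uminus, subst degree_add_eq_left) (auto simp: degree_monom_eq)
  then have "lead_coeff q = 1"
    unfolding q_def using s by auto
  moreover have "poly q y = 0"
  proof -
    have "y ^ Suc n = y ^ n * poly p (inverse y)" using p by simp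
    also have "\<dots> = (\<Sum>i\<le>n. coeff p i * (y ^ n * inverse y ^ i))"
      by (simp add: poly_altdef n_def sum_distrib_left algebra_simps)
    also have "\<dots> = (\<Sum>i\<le>n. coeff p i * y ^ (n - i))"
      by (intro sum.cong refl) (use y0 in \<open>auto simp: power_diff power_inverse divide_simps\<close>)
    finally show ?thesis by (simp add: q_def poly_monom poly_sum)
  qed
  ultimately have "y \<in> R"
    using ic coeff_in[OF q] unfolding integrally_closed_def by blast
  with y show False by simp
qed

text \<open>Zorn's lemma, with \<open>adjoin R (inverse y)\<close> as the bound of the empty chain.
  Keeping \<open>inverse y\<close> in a ring that avoids \<open>y\<close> makes it a non-unit there;
  this replaces the choice of a maximal ideal containing it.\<close>

lemma maximal_avoiding_subring:
  fixes R :: "'k::field set"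
  assumes "is_subring R" "integrally_closed R" "y \<notin> R"
  obtains A where "is_subring A" "R \<subseteq> A" "inverse y \<in> A" "y \<notin> A"
    "\<And>B. is_subring B \<Longrightarrow> A \<subseteq> B \<Longrightarrow> y \<notin> B \<Longrightarrow> B = A"
proof -
  define F where "F = {A. is_subring A \<and> R \<subseteq> A \<and> inverse y \<in> A \<and> y \<notin> A}"
  have "\<exists>M\<in>F. \<forall>X\<in>F. M \<subseteq> X \<longrightarrow> X = M"
  proof (rule subset_Zorn)
    fix C assume C: "subset.chain F C"
    show "\<exists>U\<in>F. \<forall>X\<in>C. X \<subseteq> U"
    proof (cases "C = {}")
      case True
      have "adjoin R (inverse y) \<in> F"
        using assms by (auto simp: F_def is_subring_adjoin adjoin_self adjoin_inverse_not_mem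
            adjoin_incl[THEN subsetD])
      then show ?thesis using True by auto
    next
      case False
      have CF: "C \<subseteq> F" using C by (simp add: subset.chain_def)
      have tot: "X \<subseteq> Y \<or> Y \<subseteq> X" if "X \<in> C" "Y \<in> C" for X Y
        using C that by (auto simp: subset.chain_def)
      have "is_subring (\<Union>C)"
        unfolding is_subring_def
      proof (intro conjI ballI)
        obtain X where "X \<in> C" using False by auto
        moreover from this have "is_subring X" using CF by (auto simp: F_def)
        ultimately show "0 \<in> \<Union>C" "1 \<in> \<Union>C" by (auto intro: subring_0 subring_1)
        fix a b assume "a \<in> \<Union>C" "b \<in> \<Union>C"
        then obtain X Y where XY: "X \<in> C" "Y \<in> C" "a \<in> X" "b \<in> Y" by auto
        then obtain Z where Z: "Z \<in> C" "a \<in> Z" "b \<in> Z" using tot by (metis subsetD)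
        then have "is_subring Z" using CF by (auto simp: F_def)
        then show "a + b \<in> \<Union>C" "a - b \<in> \<Union>C" "a * b \<in> \<Union>C"
          using Z by (auto intro: subring_intros)
      qed
      then have "\<Union>C \<in> F" using False CF by (auto simp: F_def)
      then show ?thesis by auto
    qed
  qed
  then obtain A where A: "A \<in> F" "\<And>X. X \<in> F \<Longrightarrow> A \<subseteq> X \<Longrightarrow> X = A" by blast
  show ?thesis
    by (rule that[of A]) (use A in \<open>auto simp: F_def\<close>)
qed

text \<open>If neither \<open>z\<close> nor its inverse lay in the maximal ring \<open>A\<close>,
  adjoining either one would produce \<open>y\<close>. So \<open>y\<close> would be a polynomial in
  \<open>z\<close> and also in \<open>inverse z\<close>, and such a pair of expressions can be
  shortened for ever.\<close>

lemma exists_valuation_ring: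
  fixes R :: "'k::field set"
  assumes "is_subring R" "integrally_closed R" "y \<notin> R"
  obtains V where "is_valuation_ring V" "R \<subseteq> V" "y \<notin> V"
proof -
  obtain A where A: "is_subring A" "R \<subseteq> A" "inverse y \<in> A" "y \<notin> A"
    and max: "\<And>B. is_subring B \<Longrightarrow> A \<subseteq> B \<Longrightarrow> y \<notin> B \<Longrightarrow> B = A"
    using maximal_avoiding_subring[OF assms] by metis
  define u where "u = inverse y"
  have y0: "y \<noteq> 0" using A by (auto simp: subring_0)
  have uy: "u * y = 1" "y * u = 1" using y0 by (auto simp: u_def)
  have uA: "u \<in> A" using A by (simp add: u_def)
  note P = is_subring_polys_over[OF A(1)]
  have adj: "y \<in> adjoin A z" if "z \<notin> A" for z
    using max[OF is_subring_adjoin[OF A(1)] adjoin_incl[OF A(1)]] adjoin_self[OF A(1), of z] that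
    by metis
  \<comment> \<open>The element \<open>u\<close> acts as if it lay in the Jacobson radical. If
    \<open>inverse s\<close> were missing, \<open>y\<close> would be a polynomial in it, so
    \<open>s ^ n * y\<close> would lie in \<open>A\<close>; but \<open>s ^ n = 1 - u * w\<close>, so
    this product is \<open>y - w\<close>, and \<open>y\<close> would follow.\<close>
  have unit: "1 - u * c \<noteq> 0 \<and> inverse (1 - u * c) \<in> A" if c: "c \<in> A" for c
  proof -
    define s where "s = 1 - u * c"
    have sA: "s \<in> A" unfolding s_def using A(1) uA c by (intro subring_intros)
    have s0: "s \<noteq> 0"
    proof
      assume "s = 0"
      then have "y = c" using uy by (simp add: s_def) (metis mult.assoc mult.left_neutral mult.right_neutral)
      then show False using c A by simp
    qed
    have pw: "\<exists>w\<in>A. s ^ k = 1 - u * w" for k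
    proof (induction k)
      case 0 show ?case using A(1) by (intro bexI[of _ 0]) (auto simp: subring_0)
    next
      case (Suc k)
      then obtain w where w: "w \<in> A" "s ^ k = 1 - u * w" by auto
      show ?case
      proof (rule bexI[of _ "c + w - u * c * w"])
        show "s ^ Suc k = 1 - u * (c + w - u * c * w)"
          unfolding power_Suc w(2) by (simp add: s_def algebra_simps)
        show "c + w - u * c * w \<in> A" using A(1) uA c w(1) by (intro subring_intros)
      qed
    qed
    have "inverse s \<in> A"
    proof (rule ccontr)
      assume "inverse s \<notin> A"
      then obtain p where p: "p \<in> polys_over A" "y = poly p (inverse s)"
        using adj by (auto simp: adjoin_def)
      define n where "n = degree p"
      have "s ^ n * y = (\<Sum>i\<le>n. coeff p i * (s ^ n * inverse s ^ i))"
        by (subst p(2)) (simp add: poly_altdef n_def sum_distrib_left algebra_simps)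
      also have "\<dots> = (\<Sum>i\<le>n. coeff p i * s ^ (n - i))"
        by (intro sum.cong refl) (use s0 in \<open>auto simp: power_diff power_inverse divide_simps\<close>)
      also have "\<dots> \<in> A" using A(1) p sA by (intro subring_intros) (auto simp: coeff_in)
      finally have sy: "s ^ n * y \<in> A" .
      obtain w where w: "w \<in> A" "s ^ n = 1 - u * w" using pw by blast
      have "y = s ^ n * y + w" using uy by (simp add: w algebra_simps)
      then show False using sy w A(1,4) by (metis subring_add)
    qed
    then show ?thesis using s0 by (simp add: s_def)
  qed
  have step: "\<exists>p'\<in>polys_over A. y = poly p' z \<and> degree p' < degree p"
    if z: "z \<noteq> 0" and p: "p \<in> polys_over A" "y = poly p z"
      and q: "q \<in> polys_over A" "y = poly q (inverse z)" and d: "degree q \<le> degree p" for z p q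
  proof -
    define m where "m = degree q"
    define n where "n = degree p"
    define s where "s = 1 - u * coeff q 0"
    have s: "s \<noteq> 0" "inverse s \<in> A" using unit[of "coeff q 0"] q by (auto simp: s_def coeff_in)
    have m0: "m > 0"
    proof (rule ccontr)
      assume "\<not> m > 0"
      then obtain c where "q = [:c:]" using degree_eq_zeroE[of q] by (auto simp: m_def)
      then have "y = coeff q 0" using q by simp
      then show False using A q by (auto simp: coeff_in)
    qed
    \<comment> \<open>In \<open>1 = u * poly q (inverse z)\<close> the constant term is moved to the
      left, where it leaves the unit \<open>s\<close>. Division by \<open>s\<close> and
      multiplication by \<open>z ^ m\<close> express \<open>z ^ m\<close> by lower powers of
      \<open>z\<close>; this is then substituted into the leading term of \<open>p\<close>.\<close>
    define E where "E = (\<Sum>i=1..m. monom (inverse s * u * coeff q i) (m - i))"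
    have EA: "E \<in> polys_over A" unfolding E_def
      using P A(1) s uA q by (intro subring_sum[OF P] monom_in_polys_over subring_intros) (auto simp: coeff_in)
    have Ez: "poly E z = z ^ m"
    proof -
      have "1 = u * (\<Sum>i\<le>m. coeff q i * inverse z ^ i)"
        using uy q by (simp add: poly_altdef m_def)
      also have "{..m} = insert 0 {1..m}" using m0 by auto
      finally have "s = (\<Sum>i=1..m. u * coeff q i * inverse z ^ i)"
        by (simp add: s_def algebra_simps sum_distrib_left)
      then have "1 = inverse s * (\<Sum>i=1..m. u * coeff q i * inverse z ^ i)"
        using s by (metis left_inverse)
      then have "z ^ m = z ^ m * (inverse s * (\<Sum>i=1..m. u * coeff q i * inverse z ^ i))"
        by (metis mult.right_neutral)
      also have "\<dots> = (\<Sum>i=1..m. inverse s * u * coeff q i * (z ^ m * inverse z ^ i))"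
        by (simp add: sum_distrib_left algebra_simps)
      also have "\<dots> = (\<Sum>i=1..m. inverse s * u * coeff q i * z ^ (m - i))"
        by (intro sum.cong refl) (use z in \<open>auto simp: power_diff power_inverse divide_simps\<close>)
      also have "\<dots> = poly E z"
        by (simp add: E_def poly_sum poly_monom)
      finally show ?thesis by simp
    qed
    define a where "a = lead_coeff p"
    define p' where "p' = p - monom a n + smult a (monom 1 (n - m) * E)"
    have aA: "a \<in> A" using p by (simp add: a_def coeff_in)
    have "p' \<in> polys_over A" unfolding p'_def
      using P A(1) p EA aA
      by (intro subring_add[OF P] subring_diff[OF P] smult_in_polys_over subring_mult[OF P] monom_in_polys_over subring_1)
    moreover have "poly p' z = y"
      using d by (simp add: p'_def poly_monom Ez p n_def m_def flip: power_add)
    moreover have "degree p' < degree p"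
    proof -
      have n0: "n > 0" using d m0 by (simp add: n_def m_def)
      have cE: "coeff E k = 0" if "k \<ge> m" for k
        using that m0 by (auto simp: E_def coeff_sum intro!: sum.neutral)
      have "coeff p' k = 0" if "k \<ge> n" for k
      proof -
        have "coeff (monom 1 (n - m) * E) k = 0"
          using that d by (auto simp: coeff_monom_mult n_def m_def intro!: cE)
        moreover have "coeff p k = coeff (monom a n) k"
          using that by (auto simp: a_def n_def coeff_eq_0)
        ultimately show ?thesis by (simp add: p'_def)
      qed
      then have "degree p' \<le> n - 1" by (intro degree_le) auto
      then show ?thesis using n0 by (simp add: n_def)
    qed
    ultimately show ?thesis by auto
  qed
  \<comment> \<open>The situation is symmetric in \<open>z\<close> and \<open>inverse z\<close>, so
    it is always the longer of the two expressions that is shortened.\<close>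
  have no: False if z: "z \<noteq> 0" and p: "p \<in> polys_over A" "y = poly p z"
      and q: "q \<in> polys_over A" "y = poly q (inverse z)" for z p q
    using z p q
  proof (induction "degree p + degree q" arbitrary: p q z rule: less_induct)
    case less
    show False
    proof (cases "degree q \<le> degree p")
      case True
      then obtain p' where "p' \<in> polys_over A" "y = poly p' z" "degree p' < degree p"
        using step[of z p q] less.prems by auto
      then show False using less.hyps[of p' q z] less.prems by auto
    next
      case False
      then obtain q' where "q' \<in> polys_over A" "y = poly q' (inverse z)" "degree q' < degree q"
        using step[of "inverse z" q p] less.prems by auto
      then show False using less.hyps[of p q' z] less.prems by auto
    qed
  qed
  have "z \<in> A \<or> inverse z \<in> A" for z
  proof (rule ccontr)
    assume *: "\<not> (z \<in> A \<or> inverse z \<in> A)"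
    then have "z \<noteq> 0" using A(1) by (auto simp: subring_0)
    moreover obtain p where "p \<in> polys_over A" "y = poly p z" using * adj by (auto simp: adjoin_def)
    moreover obtain q where "q \<in> polys_over A" "y = poly q (inverse z)" using * adj[of "inverse z"]
      by (auto simp: adjoin_def)
    ultimately show False using no by blast
  qed
  then have "is_valuation_ring A" using A(1) by (auto simp: is_valuation_ring_def)
  then show ?thesis using A that by blast
qed


section \<open>Orders on torsion-free monoids\<close>

definition nsum :: "nat \<Rightarrow> 'm::cancel_comm_monoid_add \<Rightarrow> 'm" where
  "nsum n a = (\<Sum>i<n. a)"

lemma nsum_0 [simp]: "nsum 0 a = 0"
  and nsum_Suc: "nsum (Suc n) a = nsum n a + a"
  and nsum_add: "nsum n (a + b) = nsum n a + nsum n b"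
  by (simp_all add: nsum_def sum.distrib)

lemma nsum_add_left: "nsum (m + n) a = nsum m a + nsum n a"
  by (induction n) (simp_all add: nsum_Suc add_ac)

lemma nsum_nsum: "nsum m (nsum n a) = nsum (m * n) a"
  by (induction m) (simp_all add: nsum_Suc nsum_add_left add_ac)

text \<open>The last clause, closure under division by positive integers, is carried along because
  it is what keeps the relation antisymmetric when an incomparable pair is ordered.\<close>

definition compatible_order :: "('m::cancel_comm_monoid_add \<times> 'm) set \<Rightarrow> bool" where
  "compatible_order L \<longleftrightarrow> refl L \<and> trans L \<and> antisym L \<and>
     (\<forall>a b c. (a + c, b + c) \<in> L \<longleftrightarrow> (a, b) \<in> L) \<and>
     (\<forall>n a b. n > 0 \<longrightarrow> (nsum n a, nsum n b) \<in> L \<longrightarrow> (a, b) \<in> L)"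

lemma compatible_orderD:
  assumes "compatible_order L"
  shows "(a, a) \<in> L"
    and "(a, b) \<in> L \<Longrightarrow> (b, c) \<in> L \<Longrightarrow> (a, c) \<in> L"
    and "(a, b) \<in> L \<Longrightarrow> (b, a) \<in> L \<Longrightarrow> a = b"
    and "(a + c, b + c) \<in> L \<longleftrightarrow> (a, b) \<in> L"
    and "n > 0 \<Longrightarrow> (nsum n a, nsum n b) \<in> L \<Longrightarrow> (a, b) \<in> L"
proof -
  have L: "refl L" "trans L" "antisym L" "\<And>a b c. (a + c, b + c) \<in> L \<longleftrightarrow> (a, b) \<in> L"
    "\<And>n a b. n > 0 \<Longrightarrow> (nsum n a, nsum n b) \<in> L \<Longrightarrow> (a, b) \<in> L"
    using assms unfolding compatible_order_def by simp_all
  show "(a, a) \<in> L" using L(1) by (simp add: refl_on_def)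
  show "(a, b) \<in> L \<Longrightarrow> (b, c) \<in> L \<Longrightarrow> (a, c) \<in> L" using L(2) by (rule transD)
  show "(a, b) \<in> L \<Longrightarrow> (b, a) \<in> L \<Longrightarrow> a = b" using L(3) by (rule antisymD)
  show "(a + c, b + c) \<in> L \<longleftrightarrow> (a, b) \<in> L" by (rule L(4))
  show "n > 0 \<Longrightarrow> (nsum n a, nsum n b) \<in> L \<Longrightarrow> (a, b) \<in> L" by (rule L(5))
qed

lemma compatible_order_add:
  assumes L: "compatible_order L" and "(a, b) \<in> L" "(c, d) \<in> L"
  shows "(a + c, b + d) \<in> L"
proof -
  have "(a + c, b + c) \<in> L" "(c + b, d + b) \<in> L"
    using assms by (simp_all add: compatible_orderD(4))
  then show ?thesis using compatible_orderD(2)[OF L, of "a + c" "b + c" "b + d"]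
    by (simp add: add.commute)
qed

lemma compatible_order_nsum:
  "compatible_order L \<Longrightarrow> (a, b) \<in> L \<Longrightarrow> (nsum n a, nsum n b) \<in> L"
  by (induction n) (auto simp: nsum_Suc compatible_order_add compatible_orderD(1))

text \<open>\<open>M\<close> is the relation forced by adding x \<le> y: written in the quotient
  group, \<open>(a, b)\<close> is in it when a positive multiple of b - a exceeds, in the sense of
  \<open>L\<close>, a multiple of y - x.\<close>

lemma compatible_order_extend:
  assumes L: "compatible_order L" and xy: "(x, y) \<notin> L" "(y, x) \<notin> L"
  defines "M \<equiv> {(a, b). \<exists>m n. m > 0 \<and> (nsum m a + nsum n y, nsum m b + nsum n x) \<in> L}"
  shows "compatible_order M" "L \<subseteq> M" "(x, y) \<in> M"
proof -
  note D = compatible_orderD[OF L]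
  \<comment> \<open>Scaling the two relations by \<open>m2\<close> and \<open>m1\<close> gives the
    middle element \<open>b\<close> the same multiple on both sides, so that it cancels in
    \<open>tr\<close>.\<close>
  have comb: "(nsum (m2 * m1) a + nsum m1 (nsum m2 b) + nsum (m2 * n1 + m1 * n2) y,
      nsum m2 (nsum m1 b) + nsum (m1 * m2) c + nsum (m2 * n1 + m1 * n2) x) \<in> L"
    if "(nsum m1 a + nsum n1 y, nsum m1 b + nsum n1 x) \<in> L"
       "(nsum m2 b + nsum n2 y, nsum m2 c + nsum n2 x) \<in> L" for m1 m2 n1 n2 a b c
  proof -
    have "(nsum m2 (nsum m1 a + nsum n1 y) + nsum m1 (nsum m2 b + nsum n2 y),
       nsum m2 (nsum m1 b + nsum n1 x) + nsum m1 (nsum m2 c + nsum n2 x)) \<in> L"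
      using compatible_order_add[OF L compatible_order_nsum[OF L that(1)] compatible_order_nsum[OF L that(2)]] .
    then show ?thesis by (simp add: nsum_add nsum_nsum nsum_add_left add_ac)
  qed
  have tr: "(nsum (m2 * m1) a + nsum (m2 * n1 + m1 * n2) y,
      nsum (m2 * m1) c + nsum (m2 * n1 + m1 * n2) x) \<in> L"
    if "(nsum m1 a + nsum n1 y, nsum m1 b + nsum n1 x) \<in> L"
       "(nsum m2 b + nsum n2 y, nsum m2 c + nsum n2 x) \<in> L" for m1 m2 n1 n2 a b c
    using comb[OF that] D(4)[of "nsum (m2 * m1) a + nsum (m2 * n1 + m1 * n2) y" "nsum (m1 * m2) b"
        "nsum (m2 * m1) c + nsum (m2 * n1 + m1 * n2) x"]
    by (simp add: nsum_nsum add_ac mult_ac)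
  have cancel: "(a + c, b + c) \<in> M \<longleftrightarrow> (a, b) \<in> M" for a b c
  proof -
    have "(nsum m (a + c) + nsum n y, nsum m (b + c) + nsum n x) \<in> L \<longleftrightarrow>
        (nsum m a + nsum n y, nsum m b + nsum n x) \<in> L" for m n
      using D(4)[of "nsum m a + nsum n y" "nsum m c" "nsum m b + nsum n x"]
      by (simp add: nsum_add add_ac)
    then show ?thesis by (simp add: M_def)
  qed
  have "L \<subseteq> M"
  proof
    fix p assume "p \<in> L"
    then have "(nsum 1 (fst p) + nsum 0 y, nsum 1 (snd p) + nsum 0 x) \<in> L" by (simp add: nsum_Suc)
    then have "(fst p, snd p) \<in> M" unfolding M_def by blast
    then show "p \<in> M" by simp
  qed
  then have "refl M" unfolding refl_on_def using D(1) by blast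
  moreover have "trans M"
  proof (rule transI)
    fix a b c assume "(a, b) \<in> M" "(b, c) \<in> M"
    then obtain m1 n1 m2 n2 where m: "m1 > 0" "m2 > 0"
      "(nsum m1 a + nsum n1 y, nsum m1 b + nsum n1 x) \<in> L"
      "(nsum m2 b + nsum n2 y, nsum m2 c + nsum n2 x) \<in> L" unfolding M_def by auto
    have "m2 * m1 > 0" using m(1,2) by simp
    then show "(a, c) \<in> M" unfolding M_def using tr[OF m(3,4)] by blast
  qed
  moreover have "antisym M"
  proof (rule antisymI)
    fix a b assume "(a, b) \<in> M" "(b, a) \<in> M"
    then obtain m1 n1 m2 n2 where m: "m1 > 0" "m2 > 0"
      "(nsum m1 a + nsum n1 y, nsum m1 b + nsum n1 x) \<in> L"
      "(nsum m2 b + nsum n2 y, nsum m2 a + nsum n2 x) \<in> L" unfolding M_def by auto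
    have "(nsum (m2 * n1 + m1 * n2) y, nsum (m2 * n1 + m1 * n2) x) \<in> L"
      using tr[OF m(3,4)]
      by (subst D(4)[of _ "nsum (m2 * m1) a", symmetric]) (simp only: add.commute)
    then have "m2 * n1 + m1 * n2 = 0"
      using D(5)[of "m2 * n1 + m1 * n2" y x] xy by blast
    then have "n1 = 0" "n2 = 0" using m by auto
    then have "(a, b) \<in> L" "(b, a) \<in> L"
      using m(3,4) D(5)[OF m(1), of a b] D(5)[OF m(2), of b a] by simp_all
    then show "a = b" using D(3) by blast
  qed
  moreover have "(a, b) \<in> M" if k: "k > 0" and ab: "(nsum k a, nsum k b) \<in> M" for k a b
  proof -
    from ab obtain m n where m: "m > 0" "(nsum m (nsum k a) + nsum n y, nsum m (nsum k b) + nsum n x) \<in> L"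
      unfolding M_def by auto
    then have "m * k > 0 \<and> (nsum (m * k) a + nsum n y, nsum (m * k) b + nsum n x) \<in> L"
      using k by (simp add: nsum_nsum)
    then show ?thesis unfolding M_def by blast
  qed
  ultimately show "compatible_order M" using cancel unfolding compatible_order_def
    by (intro conjI allI impI)
  show "L \<subseteq> M" by fact
  have "(nsum 1 x + nsum 1 y, nsum 1 y + nsum 1 x) \<in> L" by (simp add: add.commute D(1))
  then show "(x, y) \<in> M" unfolding M_def by blast
qed

text \<open>For the equality relation the division clause is exactly torsion-freeness, so the family
  is nonempty; a maximal member is total by the extension lemma.\<close>

lemma exists_total_compatible_order:
  assumes tf: "torsion_free_quotient TYPE('m::cancel_comm_monoid_add)"
  obtains L :: "('m::cancel_comm_monoid_add \<times> 'm) set" where "compatible_order L" "total L"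
proof -
  have Id: "compatible_order (Id :: ('m \<times> 'm) set)"
    using tf unfolding compatible_order_def torsion_free_quotient_def nsum_def
    by (auto simp: refl_on_def trans_def antisym_def)
  have "\<exists>M\<in>{L::('m \<times> 'm) set. compatible_order L}. \<forall>X\<in>{L. compatible_order L}. M \<subseteq> X \<longrightarrow> X = M"
  proof (rule subset_Zorn)
    fix C :: "('m \<times> 'm) set set" assume C: "subset.chain {L. compatible_order L} C"
    show "\<exists>U\<in>{L. compatible_order L}. \<forall>X\<in>C. X \<subseteq> U"
    proof (cases "C = {}")
      case True
      then show ?thesis using Id by auto
    next
      case False
      have CF: "compatible_order X" if "X \<in> C" for X using C that by (auto simp: subset.chain_def)
      have tot: "\<exists>Z\<in>C. p \<in> Z \<and> q \<in> Z" if "p \<in> \<Union>C" "q \<in> \<Union>C" for p q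
      proof -
        obtain X Y where "X \<in> C" "Y \<in> C" "p \<in> X" "q \<in> Y" using \<open>p \<in> \<Union>C\<close> \<open>q \<in> \<Union>C\<close> by auto
        moreover have "X \<subseteq> Y \<or> Y \<subseteq> X" using C calculation by (auto simp: subset.chain_def)
        ultimately show ?thesis by blast
      qed
      have "refl (\<Union>C)"
        using False compatible_orderD(1)[OF CF] unfolding refl_on_def by (metis UnionI ex_in_conv)
      moreover have "trans (\<Union>C)"
      proof (rule transI)
        fix a b c assume "(a, b) \<in> \<Union>C" "(b, c) \<in> \<Union>C"
        then obtain Z where "Z \<in> C" "(a, b) \<in> Z" "(b, c) \<in> Z" using tot by blast
        then show "(a, c) \<in> \<Union>C" using CF[of Z] compatible_orderD(2)[of Z a b c] by blast
      qed
      moreover have "antisym (\<Union>C)"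
      proof (rule antisymI)
        fix a b assume "(a, b) \<in> \<Union>C" "(b, a) \<in> \<Union>C"
        then obtain Z where "Z \<in> C" "(a, b) \<in> Z" "(b, a) \<in> Z" using tot by blast
        then show "a = b" using CF[of Z] compatible_orderD(3)[of Z a b] by blast
      qed
      moreover have "(a + c, b + c) \<in> \<Union>C \<longleftrightarrow> (a, b) \<in> \<Union>C" for a b c
      proof -
        have "(a + c, b + c) \<in> Z \<longleftrightarrow> (a, b) \<in> Z" if "Z \<in> C" for Z
          using compatible_orderD(4)[OF CF[OF that]] .
        then show ?thesis by auto
      qed
      moreover have "(a, b) \<in> \<Union>C" if n: "n > 0" and ab: "(nsum n a, nsum n b) \<in> \<Union>C" for n a b
      proof -
        obtain Z where "Z \<in> C" "(nsum n a, nsum n b) \<in> Z" using ab by auto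
        then show ?thesis using CF[of Z] compatible_orderD(5)[of Z n a b] n by blast
      qed
      ultimately have "compatible_order (\<Union>C)" unfolding compatible_order_def by (intro conjI allI impI)
      then show ?thesis by auto
    qed
  qed
  then obtain L :: "('m \<times> 'm) set" where L: "compatible_order L"
    and max: "\<And>X. compatible_order X \<Longrightarrow> L \<subseteq> X \<Longrightarrow> X = L" by blast
  have "total L"
  proof (rule totalI)
    fix x y :: 'm
    show "(x, y) \<in> L \<or> (y, x) \<in> L"
      using compatible_order_extend[OF L, of x y] max[OF compatible_order_extend(1)[OF L, of x y]]
      by blast
  qed
  then show ?thesis using L that by blast
qed

lemma finite_total_order_max:
  assumes "finite S" "S \<noteq> {}" "total L" "trans L" "refl L"
  obtains m where "m \<in> S" "\<And>s. s \<in> S \<Longrightarrow> (s, m) \<in> L"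
proof -
  have "\<exists>m\<in>S. \<forall>s\<in>S. (s, m) \<in> L"
    using assms(1,2)
  proof (induction S rule: finite_ne_induct)
    case (singleton x)
    then show ?case using assms(5) by (auto simp: refl_on_def)
  next
    case (insert x S)
    then obtain m where m: "m \<in> S" "\<forall>s\<in>S. (s, m) \<in> L" by auto
    show ?case
    proof (cases "(x, m) \<in> L")
      case True then show ?thesis using m by auto
    next
      case False
      then have "(m, x) \<in> L" "(x, x) \<in> L"
        using assms(3,5) by (auto simp: total_on_def refl_on_def, metis)
      then show ?thesis using m assms(4) by (auto dest: transD)
    qed
  qed
  then show ?thesis using that by blast
qed

text \<open>Take \<open>s\<close> and \<open>t\<close> largest in a total compatible order: then s'
  + t' \<le> s + t' \<le> s + t, and equality of the ends forces equality in both steps.\<close>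

lemma unique_sum_pair:
  fixes S T :: "'m::cancel_comm_monoid_add set"
  assumes tf: "torsion_free_quotient TYPE('m)"
    and "finite S" "S \<noteq> {}" "finite T" "T \<noteq> {}"
  obtains s t where "s \<in> S" "t \<in> T"
    "\<And>s' t'. s' \<in> S \<Longrightarrow> t' \<in> T \<Longrightarrow> s' + t' = s + t \<Longrightarrow> s' = s \<and> t' = t"
proof -
  obtain L :: "('m \<times> 'm) set" where L: "compatible_order L" "total L"
    using exists_total_compatible_order[OF tf] by blast
  note D = compatible_orderD[OF L(1)]
  have *: "trans L" "refl L" using L unfolding compatible_order_def by auto
  obtain s where s: "s \<in> S" "\<And>x. x \<in> S \<Longrightarrow> (x, s) \<in> L"
    using finite_total_order_max assms L * by metis
  obtain t where t: "t \<in> T" "\<And>x. x \<in> T \<Longrightarrow> (x, t) \<in> L"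
    using finite_total_order_max assms L * by metis
  show ?thesis
  proof (rule that[of s t])
    fix s' t' assume st: "s' \<in> S" "t' \<in> T" "s' + t' = s + t"
    have "(s' + t', s + t') \<in> L" using s st D(4) by blast
    moreover have "(t' + s, t + s) \<in> L" using t st D(4) by blast
    ultimately have "s' + t' = s + t'" using D(3)[of "s + t'" "s + t"] st(3) by (simp add: add.commute)
    then show "s' = s \<and> t' = t" using st by auto
  qed (use s t in auto)
qed

section \<open>Products of coefficients over integrally closed rings\<close>

lemma valuation_ring_one_plus_unit:
  assumes V: "is_valuation_ring V" and e: "e \<in> V" "e = 0 \<or> inverse e \<notin> V"
  shows "1 + e \<noteq> 0" "inverse (1 + e) \<in> V"
proof -
  have sub: "is_subring V" using V by (simp add: is_valuation_ring_def)
  show ne: "1 + e \<noteq> 0"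
  proof
    assume "1 + e = 0"
    then have "e = - 1" by (simp add: add_eq_0_iff)
    then show False using e(2) sub by (auto simp: subring_intros)
  qed
  show "inverse (1 + e) \<in> V"
  proof (cases "e = 0")
    case True then show ?thesis using sub by (simp add: subring_1)
  next
    case False
    then have ie: "inverse e \<notin> V" using e by auto
    show ?thesis
    proof (rule ccontr)
      assume n: "inverse (1 + e) \<notin> V"
      \<comment> \<open>In a valuation ring \<open>z\<close> or its inverse is present: the first
        would give \<open>inverse e = z - 1\<close>, the second gives
        \<open>inverse (1 + e) = 1 - inverse z\<close>.\<close>
      define z where "z = (1 + e) / e"
      show False
      proof (cases "z \<in> V")
        case True
        moreover have "inverse e = z - 1" using False by (simp add: z_def field_simps)
        ultimately show False using ie sub by (simp add: subring_intros)
      next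
        case no: False
        then have "inverse z \<in> V" using V by (auto simp: is_valuation_ring_def)
        moreover have "inverse (1 + e) = 1 - inverse z" using False ne by (simp add: z_def field_simps)
        ultimately show False using n sub by (simp add: subring_intros)
      qed
    qed
  qed
qed

text \<open>The maximal ideal of a valuation ring. Zero is listed separately because
  \<open>inverse 0 = 0\<close> would count it as a unit.\<close>

definition nonunits :: "'k::field set \<Rightarrow> 'k set" where
  "nonunits V = {e \<in> V. e = 0 \<or> inverse e \<notin> V}"

lemma nonunits_mult:
  assumes V: "is_subring V" and "a \<in> V" "e \<in> nonunits V"
  shows "a * e \<in> nonunits V"
proof -
  have "inverse e \<in> V" if "a \<noteq> 0" "e \<noteq> 0" "inverse (a * e) \<in> V"
  proof -
    have "inverse e = a * inverse (a * e)" using that by simp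
    then show ?thesis using that assms by (metis subring_mult)
  qed
  then show ?thesis using assms by (auto simp: nonunits_def subring_mult)
qed

text \<open>One of \<open>d / e\<close>, \<open>e / d\<close> lies in \<open>V\<close>, so the sum
  is a multiple, with factor in \<open>V\<close>, of one of the two summands.\<close>

lemma nonunits_add:
  assumes V: "is_valuation_ring V" and d: "d \<in> nonunits V" and e: "e \<in> nonunits V"
  shows "d + e \<in> nonunits V"
proof -
  have sub: "is_subring V" using V by (simp add: is_valuation_ring_def)
  have *: "d + e \<in> nonunits V" if "d \<in> nonunits V" "e \<in> nonunits V" "d / e \<in> V" "e \<noteq> 0" for d e
  proof -
    have "(d / e + 1) * e \<in> nonunits V" using that sub by (intro nonunits_mult) (auto simp: subring_intros)
    moreover have "(d / e + 1) * e = d + e" using that by (simp add: field_simps)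
    ultimately show ?thesis by simp
  qed
  consider "e = 0" | "d = 0" | "e \<noteq> 0" "d \<noteq> 0" "d / e \<in> V" | "e \<noteq> 0" "d \<noteq> 0" "e / d \<in> V"
    using V unfolding is_valuation_ring_def by (metis inverse_divide)
  then show ?thesis
    using *[of d e] *[of e d] d e by cases (auto simp: add.commute)
qed

lemma nonunits_sum:
  "is_valuation_ring V \<Longrightarrow> (\<And>i. i \<in> I \<Longrightarrow> f i \<in> nonunits V) \<Longrightarrow> sum f I \<in> nonunits V"
proof (induction I rule: infinite_finite_induct)
  case (insert i I)
  then show ?case by (simp add: nonunits_add)
qed (auto simp: nonunits_def is_valuation_ring_def subring_0)

lemma valuation_ring_max:
  assumes V: "is_valuation_ring V" and "finite S" "\<exists>m\<in>S. a m \<noteq> 0"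
  obtains m where "m \<in> S" "a m \<noteq> 0" "\<And>s. s \<in> S \<Longrightarrow> a s / a m \<in> V"
proof -
  have sub: "is_subring V" using V by (simp add: is_valuation_ring_def)
  \<comment> \<open>The preorder of divisibility. Since division by \<open>0\<close> yields
    \<open>0\<close>, the first clause is needed to place vanishing entries at the bottom and not at
    the top.\<close>
  define L where "L = {(s, m). (a m = 0 \<longrightarrow> a s = 0) \<and> a s / a m \<in> V}"
  have "total L"
  proof (rule totalI)
    fix s t
    have "a s / a t \<in> V \<or> a t / a s \<in> V"
      using V unfolding is_valuation_ring_def by (metis inverse_divide)
    then show "(s, t) \<in> L \<or> (t, s) \<in> L"
      using sub by (cases "a s = 0"; cases "a t = 0") (auto simp: L_def subring_0)
  qed
  moreover have "trans L"
  proof (rule transI)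
    fix r s t assume *: "(r, s) \<in> L" "(s, t) \<in> L"
    then have "(a r / a s) * (a s / a t) \<in> V"
      by (intro subring_mult[OF sub]) (auto simp: L_def)
    moreover have "(a r / a s) * (a s / a t) = a r / a t" if "a s \<noteq> 0" using that by simp
    ultimately show "(r, t) \<in> L" using * sub by (cases "a s = 0") (auto simp: L_def subring_0)
  qed
  moreover have "refl L" unfolding refl_on_def L_def using sub by (auto simp: subring_0 subring_1 divide_self_if)
  moreover have "S \<noteq> {}" using assms by auto
  ultimately obtain m where m: "m \<in> S" "\<And>s. s \<in> S \<Longrightarrow> (s, m) \<in> L"
    using finite_total_order_max assms by metis
  show ?thesis
  proof (rule that[of m])
    show "m \<in> S" by fact
    show "a m \<noteq> 0" using m(2) assms(3) unfolding L_def by blast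
    show "a s / a m \<in> V" if "s \<in> S" for s using m(2)[OF that] by (simp add: L_def)
  qed
qed

text \<open>A generalization of Dedekind's Prague theorem to coefficients indexed by a torsion-free monoid:
  with respect to a valuation ring, the two families of coefficients of minimal value contain a
  pair of indices with a unique sum, so the corresponding coefficient of the product has minimal value.\<close>

lemma coefficient_products_in_integrally_closed:
  fixes R :: "'k::field set" and a b :: "'m::cancel_comm_monoid_add \<Rightarrow> 'k"
  assumes tf: "torsion_free_quotient TYPE('m)"
    and R: "is_subring R" "integrally_closed R"
    and fin: "finite S" "finite T"
    and c: "\<And>p. x * (\<Sum>(m, n)\<in>{(m, n). m \<in> S \<and> n \<in> T \<and> m + n = p}. a m * b n) \<in> R"
    and mn: "m \<in> S" "n \<in> T"
  shows "x * (a m * b n) \<in> R"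
proof (rule ccontr)
  assume no: "x * (a m * b n) \<notin> R"
  obtain V where V: "is_valuation_ring V" and RV: "R \<subseteq> V" and nV: "x * (a m * b n) \<notin> V"
    using exists_valuation_ring[OF R no] by blast
  have sub: "is_subring V" using V by (simp add: is_valuation_ring_def)
  have nz: "a m \<noteq> 0" "b n \<noteq> 0" using nV sub by (auto simp: subring_0)
  obtain m0 where m0: "m0 \<in> S" "a m0 \<noteq> 0" "\<And>s. s \<in> S \<Longrightarrow> a s / a m0 \<in> V"
    using valuation_ring_max[OF V fin(1)] nz mn by metis
  obtain n0 where n0: "n0 \<in> T" "b n0 \<noteq> 0" "\<And>s. s \<in> T \<Longrightarrow> b s / b n0 \<in> V"
    using valuation_ring_max[OF V fin(2)] nz mn by metis
  \<comment> \<open>The indices of minimal value: those for which the quotient by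
    \<open>a m0\<close> is a unit of \<open>V\<close>.\<close>
  define S' where "S' = {s\<in>S. a s / a m0 \<notin> nonunits V}"
  define T' where "T' = {s\<in>T. b s / b n0 \<notin> nonunits V}"
  have one: "1 \<notin> nonunits V" using sub by (auto simp: nonunits_def subring_1)
  have ne: "S' \<noteq> {}" "T' \<noteq> {}" using m0 n0 one by (auto simp: S'_def T'_def)
  have fin': "finite S'" "finite T'" using fin by (auto simp: S'_def T'_def)
  obtain s t where st: "s \<in> S'" "t \<in> T'"
    and uniq: "\<And>s' t'. s' \<in> S' \<Longrightarrow> t' \<in> T' \<Longrightarrow> s' + t' = s + t \<Longrightarrow> s' = s \<and> t' = t"
    using unique_sum_pair[OF tf fin'(1) ne(1) fin'(2) ne(2)] by metis
  have sv: "a s \<noteq> 0" "a m0 / a s \<in> V" "s \<in> S"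
    using st m0(3)[of s] sub by (auto simp: S'_def nonunits_def)
  have tv: "b t \<noteq> 0" "b n0 / b t \<in> V" "t \<in> T"
    using st n0(3)[of t] sub by (auto simp: T'_def nonunits_def)
  define P where "P = {(m, n). m \<in> S \<and> n \<in> T \<and> m + n = s + t}"
  have finP: "finite P"
    by (rule finite_subset[of _ "S \<times> T"]) (use fin in \<open>auto simp: P_def\<close>)
  define c0 where "c0 = (\<Sum>(m, n)\<in>P. a m * b n)"
  \<comment> \<open>The other contributions to the coefficient at \<open>s + t\<close>, relative to
    the main term. By uniqueness each of them has an index outside \<open>S'\<close> or
    \<open>T'\<close>, hence is a non-unit; so \<open>1 + e\<close> is a unit, and the coefficient
    has the same value as \<open>a s * b t\<close>.\<close>
  define e where "e = (\<Sum>(m, n)\<in>P - {(s, t)}. (a m * b n) / (a s * b t))"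
  have ce: "c0 = (a s * b t) * (1 + e)"
  proof -
    have "c0 = a s * b t + (\<Sum>(m, n)\<in>P - {(s, t)}. a m * b n)"
      unfolding c0_def using finP sv tv by (subst sum.remove[of _ "(s, t)"]) (auto simp: P_def)
    also have "(\<Sum>(m, n)\<in>P - {(s, t)}. a m * b n) = (a s * b t) * e"
      unfolding e_def sum_distrib_left using sv tv by (intro sum.cong) auto
    finally show ?thesis by (simp add: algebra_simps)
  qed
  have "e \<in> nonunits V"
    unfolding e_def
  proof (rule nonunits_sum[OF V])
    fix p assume p: "p \<in> P - {(s, t)}"
    then obtain m n where pmn: "p = (m, n)" and mn: "m = s \<longrightarrow> n \<noteq> t"
      by (cases p) auto
    have mS: "m \<in> S" "n \<in> T" "m + n = s + t" using p by (auto simp: P_def pmn)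
    have eq: "(a m * b n) / (a s * b t) =
        ((a m0 / a s) * (b n0 / b t)) * ((a m / a m0) * (b n / b n0))"
      using m0 n0 by simp
    have u: "(a m0 / a s) * (b n0 / b t) \<in> V" using sv tv sub by (intro subring_mult)
    have "m \<notin> S' \<or> n \<notin> T'" using uniq[of m n] mS mn by auto
    then have "a m / a m0 \<in> nonunits V \<or> b n / b n0 \<in> nonunits V" using mS by (auto simp: S'_def T'_def)
    then have "(a m / a m0) * (b n / b n0) \<in> nonunits V"
      using nonunits_mult[OF sub m0(3)[OF mS(1)]] nonunits_mult[OF sub n0(3)[OF mS(2)]]
      by (metis mult.commute)
    then show "(case p of (m, n) \<Rightarrow> a m * b n / (a s * b t)) \<in> nonunits V"
      unfolding pmn prod.case eq using nonunits_mult[OF sub u] by blast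
  qed
  then have e: "1 + e \<noteq> 0" "inverse (1 + e) \<in> V"
    using valuation_ring_one_plus_unit[OF V, of e] by (auto simp: nonunits_def)
  have xc: "x * c0 \<in> V" using c[of "s + t"] RV by (auto simp: c0_def P_def)
  have "(x * c0) * inverse (1 + e) = x * (a s * b t)"
    unfolding ce using e(1) by (metis mult.assoc right_inverse mult.right_neutral)
  moreover have "(x * c0) * inverse (1 + e) \<in> V" using subring_mult[OF sub xc e(2)] .
  ultimately have "x * (a s * b t) \<in> V" by metis
  \<comment> \<open>This factor in \<open>V\<close> converts \<open>a s * b t\<close>, of minimal
    value, into the arbitrary product \<open>a m * b n\<close>.\<close>
  moreover have "(a m / a m0) * (b n / b n0) * ((a m0 / a s) * (b n0 / b t)) \<in> V"
    using m0(3)[OF mn(1)] n0(3)[OF mn(2)] sv(2) tv(2) by (intro subring_mult[OF sub])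
  ultimately have "(a m / a m0) * (b n / b n0) * ((a m0 / a s) * (b n0 / b t)) * (x * (a s * b t)) \<in> V"
    by (rule subring_mult[OF sub, rotated])
  also have "(a m / a m0) * (b n / b n0) * ((a m0 / a s) * (b n0 / b t)) * (x * (a s * b t)) = x * (a m * b n)"
    using sv(1) tv(1) m0(2) n0(2) by simp
  finally show False using nV by simp
qed

section \<open>Complete integral closure and Laurent polynomials\<close>

text \<open>Here \<open>y\<close> ranges over the ambient field; as \<open>d\<close> and
  \<open>d * y\<close> are in \<open>A\<close>, it automatically lies in the quotient field of
  \<open>A\<close>, so this is the usual notion.\<close>

definition completely_integrally_closed :: "'k::field set \<Rightarrow> bool" where
  "completely_integrally_closed A \<longleftrightarrow>
     (\<forall>d y. d \<in> A \<longrightarrow> d \<noteq> 0 \<longrightarrow> (\<forall>k. d * y ^ k \<in> A) \<longrightarrow> y \<in> A)"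

lemma completely_integrally_closedD:
  "completely_integrally_closed A \<Longrightarrow> d \<in> A \<Longrightarrow> d \<noteq> 0 \<Longrightarrow> (\<And>k. d * y ^ k \<in> A) \<Longrightarrow> y \<in> A"
  unfolding completely_integrally_closed_def by blast

text \<open>Up to the exponent \<open>degree p\<close> the power of \<open>b\<close> clears the
  denominator; beyond it the equation rewrites the power of \<open>a / b\<close> by lower
  ones.\<close>

lemma integral_imp_almost_integral:
  fixes A :: "'k::field set"
  assumes A: "is_subring A" "a \<in> A" "b \<in> A" "b \<noteq> 0"
    and p: "p \<in> polys_over A" "lead_coeff p = 1" "poly p (a / b) = 0"
  shows "b ^ degree p * (a / b) ^ k \<in> A"
proof (induction k rule: less_induct)
  case (less k)
  define n where "n = degree p"
  define x where "x = a / b"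
  show ?case
  proof (cases "k \<le> n")
    case True
    then have "b ^ n * (a / b) ^ k = b ^ (n - k) * a ^ k"
      using A(4) by (simp add: power_divide power_diff)
    then show ?thesis using A by (simp add: n_def subring_mult subring_power)
  next
    case False
    then have k: "k = (k - n) + n" by simp
    have "0 = (\<Sum>i\<le>n. coeff p i * x ^ i)" using p(3) by (simp add: poly_altdef n_def x_def)
    also have "\<dots> = (\<Sum>i<n. coeff p i * x ^ i) + x ^ n"
      using p(2) by (simp add: n_def flip: lessThan_Suc_atMost)
    finally have "x ^ n = - (\<Sum>i<n. coeff p i * x ^ i)" by (simp add: eq_neg_iff_add_eq_0 add.commute)
    then have "b ^ n * x ^ k = - (\<Sum>i<n. coeff p i * (b ^ n * x ^ (k - n + i)))"
      by (subst k) (simp add: power_add sum_distrib_left algebra_simps)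
    moreover have "b ^ n * x ^ (k - n + i) \<in> A" if "i < n" for i
      using less[of "k - n + i"] False that by (simp add: n_def x_def)
    then have "(\<Sum>i<n. coeff p i * (b ^ n * x ^ (k - n + i))) \<in> A"
      using p(1) by (intro subring_sum[OF A(1)] subring_mult[OF A(1), of "coeff p _"]) (auto simp: coeff_in)
    ultimately show ?thesis using subring_uminus[OF A(1)] by (simp add: x_def n_def)
  qed
qed

definition quotient_field :: "'k::field set \<Rightarrow> 'k set" where
  "quotient_field A = {a / b | a b. a \<in> A \<and> b \<in> A \<and> b \<noteq> 0}"

lemma quotient_fieldI: "a \<in> A \<Longrightarrow> b \<in> A \<Longrightarrow> b \<noteq> 0 \<Longrightarrow> a / b \<in> quotient_field A"
  unfolding quotient_field_def by blast

lemma is_subring_quotient_field: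
  assumes A: "is_subring A"
  shows "is_subring (quotient_field A)"
  unfolding is_subring_def
proof (intro conjI ballI)
  show "0 \<in> quotient_field A" "1 \<in> quotient_field A"
    using quotient_fieldI[of 0 A 1] quotient_fieldI[of 1 A 1] A by (simp_all add: subring_0 subring_1)
  fix x y assume "x \<in> quotient_field A" "y \<in> quotient_field A"
  then obtain a b c d where *: "a \<in> A" "b \<in> A" "b \<noteq> 0" "c \<in> A" "d \<in> A" "d \<noteq> 0" "x = a / b" "y = c / d"
    unfolding quotient_field_def by blast
  have "(a * d + c * b) / (b * d) \<in> quotient_field A" "(a * d - c * b) / (b * d) \<in> quotient_field A"
    "(a * c) / (b * d) \<in> quotient_field A"
    using A * by (auto intro!: quotient_fieldI subring_add subring_diff subring_mult)
  then show "x + y \<in> quotient_field A" "x - y \<in> quotient_field A" "x * y \<in> quotient_field A"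
    using * by (simp_all add: add_frac_eq diff_frac_eq)
qed

lemma quotient_field_inverse: "is_subring A \<Longrightarrow> x \<in> quotient_field A \<Longrightarrow> inverse x \<in> quotient_field A"
  using quotient_fieldI subring_0[OF is_subring_quotient_field] by (cases "x = 0") (force simp: quotient_field_def)+

lemma quotient_field_incl: "is_subring A \<Longrightarrow> A \<subseteq> quotient_field A"
  using quotient_fieldI[of _ A 1] by (auto simp: subring_1)

lemma clear_denominators:
  assumes A: "is_subring A" and "p \<in> polys_over (quotient_field A)"
  shows "\<exists>b\<in>A. b \<noteq> 0 \<and> smult b p \<in> polys_over A"
  using assms(2)
proof (induction p)
  case 0
  then show ?case using A by (auto intro!: bexI[of _ 1] simp: subring_1 subring_0 polys_over_def)
next
  case (pCons a p)
  have "p \<in> polys_over (quotient_field A)"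
    unfolding polys_over_def using coeff_in[OF pCons.prems, of "Suc _"] by auto
  then obtain b where b: "b \<in> A" "b \<noteq> 0" "smult b p \<in> polys_over A" using pCons.IH by blast
  have "a \<in> quotient_field A" using coeff_in[OF pCons.prems, of 0] by simp
  then obtain c d where cd: "c \<in> A" "d \<in> A" "d \<noteq> 0" "a = c / d" unfolding quotient_field_def by blast
  have "b * d * a = b * c" using cd by simp
  moreover have "smult (b * d) p \<in> polys_over A"
    using smult_in_polys_over[OF A cd(2) b(3)] by (simp add: mult.commute)
  ultimately have "smult (b * d) (pCons a p) \<in> polys_over A"
    using A b cd by (auto simp: polys_over_def coeff_pCons subring_mult split: nat.split)
  then show ?case using A b cd by (intro bexI[of _ "b * d"]) (auto simp: subring_mult)
qed

section \<open>Laurent rings inside the field\<close>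

definition laurent :: "'k::field set \<Rightarrow> 'k \<Rightarrow> 'k set" where
  "laurent A t = {poly p t / t ^ m | p m. p \<in> polys_over A}"

lemma laurentI: "p \<in> polys_over A \<Longrightarrow> poly p t / t ^ m \<in> laurent A t"
  unfolding laurent_def by blast

lemma laurent_mono: "A \<subseteq> B \<Longrightarrow> laurent A t \<subseteq> laurent B t"
  unfolding laurent_def using polys_over_mono by blast

lemma is_subring_laurent:
  assumes A: "is_subring A" and t: "t \<noteq> 0"
  shows "is_subring (laurent A t)"
  unfolding is_subring_def
proof (intro conjI ballI)
  note P = is_subring_polys_over[OF A]
  note M = monom_in_polys_over[OF A subring_1[OF A]]
  show "0 \<in> laurent A t" "1 \<in> laurent A t"
    using laurentI[of 0 A t 0] laurentI[of 1 A t 0] P by (simp_all add: subring_0 subring_1)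
  fix x y assume "x \<in> laurent A t" "y \<in> laurent A t"
  then obtain p m q n where *: "p \<in> polys_over A" "q \<in> polys_over A" "x = poly p t / t ^ m" "y = poly q t / t ^ n"
    unfolding laurent_def by blast
  have "x + y = poly (p * monom 1 n + q * monom 1 m) t / t ^ (m + n)"
    "x - y = poly (p * monom 1 n - q * monom 1 m) t / t ^ (m + n)"
    "x * y = poly (p * q) t / t ^ (m + n)"
    using * t by (simp_all add: add_frac_eq diff_frac_eq power_add poly_monom)
  moreover have "p * monom 1 n + q * monom 1 m \<in> polys_over A"
    "p * monom 1 n - q * monom 1 m \<in> polys_over A" "p * q \<in> polys_over A"
    using * M by (auto intro!: subring_add[OF P] subring_diff[OF P] subring_mult[OF P])
  ultimately show "x + y \<in> laurent A t" "x - y \<in> laurent A t" "x * y \<in> laurent A t"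
    by (simp_all only: laurentI)
qed

lemma poly_in_laurent: "p \<in> polys_over A \<Longrightarrow> poly p t \<in> laurent A t"
  using laurentI[of p A t 0] by simp

lemma laurent_incl: "is_subring A \<Longrightarrow> A \<subseteq> laurent A t"
  using poly_in_laurent[of "monom _ 0" A t] monom_in_polys_over[of A _ 0] by (auto simp: poly_monom)

lemma power_in_laurent: "is_subring A \<Longrightarrow> t ^ n \<in> laurent A t"
  using poly_in_laurent[of "monom 1 n" A t] monom_in_polys_over[of A 1 n]
  by (auto simp: poly_monom subring_1)

lemma power_int_in_laurent:
  assumes "is_subring A"
  shows "t powi k \<in> laurent A t"
proof (cases "k \<ge> 0")
  case True
  then show ?thesis using power_in_laurent[OF assms] by (simp add: power_int_def)
next
  case False
  have "poly 1 t / t ^ nat (- k) \<in> laurent A t"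
    using subring_1[OF is_subring_polys_over[OF assms]] by (rule laurentI)
  then show ?thesis using False by (simp add: power_int_def divide_inverse power_inverse)
qed

text \<open>The leading coefficient of \<open>P\<close> is invertible within \<open>L\<close>, so
  every step of the long division keeps its coefficients in the subfield \<open>L\<close>.\<close>

lemma polys_over_division:
  assumes L: "is_subring L" "\<And>x. x \<in> L \<Longrightarrow> inverse x \<in> L"
    and P: "P \<in> polys_over L" "P \<noteq> 0" and Q: "Q \<in> polys_over L"
  shows "\<exists>q\<in>polys_over L. \<exists>r\<in>polys_over L. Q = P * q + r \<and> (r = 0 \<or> degree r < degree P)"
  using Q
proof (induction "degree Q" arbitrary: Q rule: less_induct)
  case less
  note LP = is_subring_polys_over[OF L(1)]
  show ?case
  proof (cases "degree Q < degree P")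
    case True
    then show ?thesis using less.prems subring_0[OF LP] by (intro bexI[of _ 0] bexI[of _ Q]) auto
  next
    case False
    define c where "c = lead_coeff Q * inverse (lead_coeff P)"
    define M where "M = monom c (degree Q - degree P)"
    define Q' where "Q' = Q - P * M"
    have "c \<in> L" unfolding c_def using P less.prems L by (intro subring_mult L) (auto simp: coeff_in)
    then have M: "M \<in> polys_over L" unfolding M_def by (intro monom_in_polys_over L)
    have Q': "Q' \<in> polys_over L"
      unfolding Q'_def using M P less.prems by (intro subring_diff[OF LP] subring_mult[OF LP])
    have z: "coeff Q' k = 0" if "k \<ge> degree Q" for k
    proof -
      have "coeff (P * M) k = coeff P (k - (degree Q - degree P)) * c"
        unfolding M_def using that False
        by (subst mult.commute, subst coeff_monom_mult) (simp add: mult.commute)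
      also have "\<dots> = coeff Q k"
      proof (cases "k = degree Q")
        case True
        then show ?thesis using False P by (simp add: c_def)
      next
        case F: False
        then have "k - (degree Q - degree P) > degree P" using that False by linarith
        then show ?thesis using F that by (simp add: coeff_eq_0)
      qed
      finally show ?thesis by (simp add: Q'_def)
    qed
    show ?thesis
    proof (cases "degree Q = 0")
      case True
      then have "Q' = 0" using z by (intro poly_eqI) auto
      then have "Q = P * M + 0" by (simp add: Q'_def)
      then show ?thesis using M subring_0[OF LP] by blast
    next
      case F: False
      have "degree Q' \<le> degree Q - 1" by (rule degree_le) (use z F in auto)
      then have "degree Q' < degree Q" using F by simp
      then obtain q r where qr: "q \<in> polys_over L" "r \<in> polys_over L" "Q' = P * q + r"
        "r = 0 \<or> degree r < degree P" using less.hyps Q' by blast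
      have "Q = P * (q + M) + r" using qr(3) by (simp add: Q'_def algebra_simps)
      then show ?thesis using qr M subring_add[OF LP] by blast
    qed
  qed
qed

text \<open>The denominators \<open>s\<close> with \<open>s * y ^ k\<close> in the ring for all \<open>k\<close> form an ideal that is stable under
  \<open>y\<close>; since the ring is a principal ideal domain, \<open>y\<close> lies in it.\<close>

lemma completely_integrally_closed_laurent_field:
  assumes L: "is_subring L" "\<And>x. x \<in> L \<Longrightarrow> inverse x \<in> L" and t: "t \<noteq> 0"
  shows "completely_integrally_closed (laurent L t)"
  unfolding completely_integrally_closed_def
proof (intro allI impI)
  fix d y
  define S where "S = laurent L t"
  assume "d \<in> laurent L t" and d0: "d \<noteq> 0" and "\<forall>k. d * y ^ k \<in> laurent L t"
  then have d: "d \<in> S" "\<And>k. d * y ^ k \<in> S" by (auto simp: S_def)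
  have S: "is_subring S" unfolding S_def using L t by (intro is_subring_laurent)
  define J where "J = {s \<in> S. \<forall>k. s * y ^ k \<in> S}"
  have J_mult: "c * s \<in> J" if "c \<in> S" "s \<in> J" for c s
    using that S unfolding J_def by (auto simp: mult.assoc subring_mult)
  have J_diff: "r - s \<in> J" if "r \<in> J" "s \<in> J" for r s
    using that S unfolding J_def by (auto simp: left_diff_distrib subring_diff)
  have J_y: "s * y \<in> J" if s: "s \<in> J" for s
  proof -
    have "s * y ^ k \<in> S" for k using s by (auto simp: J_def)
    from this[of 1] this[of "Suc _"] show ?thesis unfolding J_def by (simp add: mult.assoc)
  qed
  have tS: "t ^ m \<in> S" for m unfolding S_def by (rule power_in_laurent[OF L(1)])
  \<comment> \<open>A polynomial of least degree whose value at \<open>t\<close> is a nonzero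
    element of \<open>J\<close> gives a generator \<open>g\<close>. The remainder of
    \<open>g * y\<close>, after clearing powers of \<open>t\<close>, then vanishes at
    \<open>t\<close> by minimality, so \<open>y\<close> is a quotient of multiples of
    \<open>g\<close>.\<close>
  define W where "W = (\<lambda>P. P \<in> polys_over L \<and> poly P t \<noteq> 0 \<and> poly P t \<in> J)"
  have "\<exists>P. W P"
  proof -
    obtain p m where p: "p \<in> polys_over L" "d = poly p t / t ^ m" using d(1) unfolding S_def laurent_def by blast
    then have "poly p t = t ^ m * d" using t by simp
    moreover have "t ^ m * d \<in> J" using d by (intro J_mult tS) (auto simp: J_def)
    ultimately have "W p" using p d0 t by (simp add: W_def)
    then show ?thesis by blast
  qed
  then obtain P where P: "W P" and least: "\<And>Q. W Q \<Longrightarrow> degree P \<le> degree Q"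
    using exists_least_iff[of "\<lambda>n. \<exists>P. W P \<and> degree P = n"] by (metis not_le_imp_less)
  define g where "g = poly P t"
  have g: "g \<noteq> 0" "g \<in> J" using P by (auto simp: W_def g_def)
  obtain Q m where Q: "Q \<in> polys_over L" "g * y = poly Q t / t ^ m"
    using J_y[OF g(2)] unfolding J_def S_def laurent_def by blast
  have P0: "P \<in> polys_over L" "P \<noteq> 0" using P by (auto simp: W_def)
  obtain q r where qr: "q \<in> polys_over L" "r \<in> polys_over L" "Q = P * q + r" "r = 0 \<or> degree r < degree P"
    using polys_over_division[OF L P0 Q(1)] by blast
  have "poly Q t = t ^ m * (g * y)" using Q(2) t by simp
  then have "poly Q t \<in> J" using J_mult[OF tS J_y[OF g(2)]] by simp
  moreover have "poly q t * g \<in> J" using poly_in_laurent[OF qr(1)] g by (intro J_mult) (auto simp: S_def)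
  moreover have "poly r t = poly Q t - poly q t * g" by (simp add: qr(3) g_def)
  ultimately have "poly r t \<in> J" using J_diff by simp
  then have "poly r t = 0" using least[of r] qr(2,4) unfolding W_def by (metis not_less poly_0)
  then have "g * y = (poly q t / t ^ m) * g" using Q(2) by (simp add: qr(3) g_def)
  then have "y * g = (poly q t / t ^ m) * g" by (simp only: mult.commute)
  then have "y = poly q t / t ^ m" using g(1) by (metis mult_right_cancel)
  then show "y \<in> laurent L t" using qr by (simp only: laurentI)
qed

text \<open>The leading coefficient of \<open>D * Q ^ k\<close> is that of \<open>D\<close> times
  the \<open>k\<close>-th power of that of \<open>Q\<close>, so the latter is almost integral over
  \<open>A\<close>. The leading term is split off and the same \<open>D\<close> serves for the rest,
  by the binomial theorem.\<close>

lemma almost_integral_poly_coeffs: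
  assumes A: "is_subring A" "completely_integrally_closed A"
    and D: "D \<in> polys_over A" "D \<noteq> 0" and DQ: "\<And>k. D * Q ^ k \<in> polys_over A"
  shows "Q \<in> polys_over A"
  using DQ
proof (induction "degree Q" arbitrary: Q rule: less_induct)
  case less
  note P = is_subring_polys_over[OF A(1)]
  define q where "q = lead_coeff Q"
  define M where "M = monom q (degree Q)"
  have "q \<in> A"
  proof (rule completely_integrally_closedD[OF A(2)])
    show "lead_coeff D \<in> A" "lead_coeff D \<noteq> 0" using D by (auto simp: coeff_in)
    fix k
    have "lead_coeff D * q ^ k = lead_coeff (D * Q ^ k)"
      by (simp only: lead_coeff_mult lead_coeff_power q_def)
    then show "lead_coeff D * q ^ k \<in> A" using coeff_in[OF less.prems] by simp
  qed
  then have M: "M \<in> polys_over A" using A by (simp add: M_def monom_in_polys_over)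
  define Q' where "Q' = Q + - M"
  have DQ': "D * Q' ^ k \<in> polys_over A" for k
  proof -
    have "D * Q' ^ k = (\<Sum>i\<le>k. of_nat (k choose i) * (D * Q ^ i) * (- M) ^ (k - i))"
      unfolding Q'_def binomial_ring sum_distrib_left by (simp only: mult_ac)
    also have "\<dots> \<in> polys_over A"
      using less.prems M by (intro subring_sum[OF P] subring_mult[OF P subring_mult[OF P]]
        subring_power[OF P] subring_uminus[OF P] subring_of_nat[OF P]) auto
    finally show ?thesis .
  qed
  have z: "coeff Q' k = 0" if "k \<ge> degree Q" for k
    using that by (cases "k = degree Q") (auto simp: Q'_def M_def q_def coeff_eq_0)
  have "Q' \<in> polys_over A"
  proof (cases "degree Q = 0")
    case True
    then have "Q' = 0" using z by (intro poly_eqI) auto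
    then show ?thesis using subring_0[OF P] by simp
  next
    case False
    have "degree Q' \<le> degree Q - 1" by (rule degree_le) (use z False in auto)
    then have "degree Q' < degree Q" using False by simp
    then show ?thesis using less.hyps DQ' by blast
  qed
  then have "Q' + M \<in> polys_over A" using M by (intro subring_add[OF P])
  then show ?case by (simp add: Q'_def)
qed

text \<open>Over the quotient field of \<open>A\<close> the Laurent ring is already settled, so
  \<open>y\<close> is the value of a polynomial \<open>Q\<close> divided by a power of
  \<open>t\<close>. Since \<open>t\<close> is transcendental, what is known about values at
  \<open>t\<close> becomes a statement about coefficients of \<open>D * Q ^ k\<close>.\<close>

lemma completely_integrally_closed_laurent:
  assumes A: "is_subring A" "completely_integrally_closed A" and t: "t \<noteq> 0"
    and trans: "\<And>p. p \<in> polys_over A \<Longrightarrow> poly p t = 0 \<Longrightarrow> p = 0"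
  shows "completely_integrally_closed (laurent A t)"
  unfolding completely_integrally_closed_def
proof (intro allI impI)
  fix d y
  assume d: "d \<in> laurent A t" "d \<noteq> 0" and "\<forall>k. d * y ^ k \<in> laurent A t"
  then have dy: "d * y ^ k \<in> laurent A t" for k by blast
  define L where "L = quotient_field A"
  have L: "is_subring L" "\<And>x. x \<in> L \<Longrightarrow> inverse x \<in> L"
    unfolding L_def using A(1) by (auto intro: is_subring_quotient_field quotient_field_inverse)
  note LP = is_subring_polys_over[OF L(1)]
  have AL: "A \<subseteq> L" unfolding L_def using A(1) by (rule quotient_field_incl)
  have transL: "p = 0" if p: "p \<in> polys_over L" "poly p t = 0" for p
  proof -
    obtain b where "b \<in> A" "b \<noteq> 0" "smult b p \<in> polys_over A"
      using clear_denominators[OF A(1)] p(1) unfolding L_def by blast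
    then show ?thesis using trans[of "smult b p"] p(2) by simp
  qed
  have "y \<in> laurent L t"
    using completely_integrally_closedD[OF completely_integrally_closed_laurent_field[OF L t]]
      d dy laurent_mono[OF AL] by blast
  then obtain Q m where Q: "Q \<in> polys_over L" "y = poly Q t / t ^ m" unfolding laurent_def by blast
  obtain D n where D: "D \<in> polys_over A" "d = poly D t / t ^ n" using d unfolding laurent_def by blast
  have DL: "D \<in> polys_over L" using D polys_over_mono[OF AL] by blast
  have "D * Q ^ k \<in> polys_over A" for k
  proof -
    obtain E j where E: "E \<in> polys_over A" "d * y ^ k = poly E t / t ^ j" using dy[of k] unfolding laurent_def by blast
    have EL: "E \<in> polys_over L" using E polys_over_mono[OF AL] by blast
    \<comment> \<open>Clearing powers of \<open>t\<close> from \<open>d * y ^ k\<close> yields X ^ j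
      * D * Q ^ k = X ^ (n + m * k) * E as polynomials. The coefficients of \<open>D * Q ^ k\<close>
      are those of the left side shifted by \<open>j\<close>, hence lie in \<open>A\<close>.\<close>
    define F where "F = monom 1 (n + m * k) * E"
    have "(poly D t * poly Q t ^ k) / t ^ (n + m * k) = poly E t / t ^ j"
      using E(2) unfolding D(2) Q(2) by (simp add: power_divide power_add power_mult)
    then have "poly (monom 1 j * (D * Q ^ k) - F) t = 0"
      using t by (simp add: F_def frac_eq_eq poly_monom mult_ac)
    moreover have "monom 1 j * (D * Q ^ k) - F \<in> polys_over L"
      unfolding F_def using DL EL Q L
      by (intro subring_diff[OF LP] subring_mult[OF LP] subring_power[OF LP] monom_in_polys_over subring_1)
    ultimately have "monom 1 j * (D * Q ^ k) = F" using transL by fastforce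
    moreover have "F \<in> polys_over A"
      unfolding F_def using E A by (intro subring_mult is_subring_polys_over monom_in_polys_over subring_1)
    ultimately have "coeff (monom 1 j * (D * Q ^ k)) (i + j) \<in> A" for i by (simp only: coeff_in)
    then show ?thesis by (simp add: coeff_monom_mult polys_over_def)
  qed
  then have "Q \<in> polys_over A"
    using almost_integral_poly_coeffs[OF A D(1)] d D by force
  then show "y \<in> laurent A t" unfolding Q(2) by (rule laurentI)
qed

section \<open>Bases of finitely generated subgroups\<close>

definition mult_subgroup :: "'k::field set \<Rightarrow> bool" where
  "mult_subgroup G \<longleftrightarrow> 0 \<notin> G \<and> 1 \<in> G \<and> (\<forall>a\<in>G. inverse a \<in> G \<and> (\<forall>b\<in>G. a * b \<in> G))"

lemma
  assumes "mult_subgroup G"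
  shows mult_subgroup_nz: "a \<in> G \<Longrightarrow> a \<noteq> 0" and mult_subgroup_1: "1 \<in> G"
    and mult_subgroup_inverse: "a \<in> G \<Longrightarrow> inverse a \<in> G"
    and mult_subgroup_mult: "a \<in> G \<Longrightarrow> b \<in> G \<Longrightarrow> a * b \<in> G"
    and mult_subgroup_divide: "a \<in> G \<Longrightarrow> b \<in> G \<Longrightarrow> a / b \<in> G"
  using assms unfolding mult_subgroup_def divide_inverse by blast+

lemma mult_subgroup_power: "mult_subgroup G \<Longrightarrow> a \<in> G \<Longrightarrow> a ^ n \<in> G"
  by (induction n) (auto simp: mult_subgroup_1 mult_subgroup_mult)

lemma mult_subgroup_power_int: "mult_subgroup G \<Longrightarrow> a \<in> G \<Longrightarrow> a powi k \<in> G"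
  by (auto simp: power_int_def mult_subgroup_power mult_subgroup_inverse)

fun mspan :: "'k::field set \<Rightarrow> 'k list \<Rightarrow> 'k set" where
  "mspan G [] = G"
| "mspan G (t # ts) = {t powi k * u | k u. u \<in> mspan G ts}"

text \<open>Independence modulo \<open>G\<close> in triangular form: in a nontrivial relation, a
  power of the first element that occurs would lie in the span of the later ones. This is the form
  in which it yields transcendence of \<open>t\<close> over the ring built from
  \<open>ts\<close>.\<close>

fun mindep :: "'k::field set \<Rightarrow> 'k list \<Rightarrow> bool" where
  "mindep G [] \<longleftrightarrow> True"
| "mindep G (t # ts) \<longleftrightarrow> (\<forall>k. k \<noteq> 0 \<longrightarrow> t powi k \<notin> mspan G ts) \<and> mindep G ts"

lemma mspan_ConsI: "u \<in> mspan G ts \<Longrightarrow> t powi k * u \<in> mspan G (t # ts)"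
  by auto

lemma mult_subgroup_mspan:
  assumes "mult_subgroup G" "0 \<notin> set ts"
  shows "mult_subgroup (mspan G ts)"
  using assms(2)
proof (induction ts)
  case Nil
  then show ?case using assms by simp
next
  case (Cons t ts)
  then have t: "t \<noteq> 0" and S: "mult_subgroup (mspan G ts)" by auto
  show ?case
    unfolding mult_subgroup_def
  proof (intro conjI ballI)
    show "0 \<notin> mspan G (t # ts)" using t mult_subgroup_nz[OF S] by auto
    show "1 \<in> mspan G (t # ts)" using mspan_ConsI[OF mult_subgroup_1[OF S], of t 0] by simp
    fix a assume "a \<in> mspan G (t # ts)"
    then obtain k u where a: "u \<in> mspan G ts" "a = t powi k * u" by auto
    have "inverse a = t powi (- k) * inverse u" by (simp add: a power_int_minus)
    then show "inverse a \<in> mspan G (t # ts)" using mult_subgroup_inverse[OF S] a mspan_ConsI by metis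
    fix b assume "b \<in> mspan G (t # ts)"
    then obtain l v where b: "v \<in> mspan G ts" "b = t powi l * v" by auto
    have "a * b = t powi (k + l) * (u * v)" using t by (simp add: a b power_int_add)
    then show "a * b \<in> mspan G (t # ts)" using mult_subgroup_mult[OF S] a b mspan_ConsI by metis
  qed
qed

lemma mspan_tail: "mspan G ts \<subseteq> mspan G (t # ts)"
  using mspan_ConsI[of _ G ts t 0] by auto

lemma mspan_head: "mult_subgroup (mspan G ts) \<Longrightarrow> t powi k \<in> mspan G (t # ts)"
  using mspan_ConsI[OF mult_subgroup_1, of G ts t k] by simp

text \<open>If \<open>u\<close> depends on the basis, say \<open>u ^ k\<close> is \<open>t ^ j\<close> times an element of the span of the remaining
  basis elements, then a unimodular change of variables replaces \<open>u\<close>, \<open>t\<close> by \<open>v\<close>, \<open>w\<close> where a power of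
  \<open>v\<close> lies in the latter span.\<close>

lemma mindep_extend:
  assumes G: "mult_subgroup G" and H: "mult_subgroup H" "G \<subseteq> H"
    and tf: "\<And>a k. a \<in> H \<Longrightarrow> k \<noteq> 0 \<Longrightarrow> a powi k \<in> G \<Longrightarrow> a \<in> G"
    and ts: "mindep G ts" "set ts \<subseteq> H" and u: "u \<in> H"
  shows "\<exists>ts'. mindep G ts' \<and> set ts' \<subseteq> H \<and> mspan G ts \<subseteq> mspan G ts' \<and> u \<in> mspan G ts' \<and>
    (\<forall>x\<in>mspan G ts'. \<exists>m i y. m \<noteq> 0 \<and> y \<in> mspan G ts \<and> x powi m = u powi i * y)"
  using ts u
proof (induction ts arbitrary: u)
  case Nil
  show ?case
  proof (cases "u \<in> G")
    case True
    have "(1::int) \<noteq> 0 \<and> x \<in> mspan G [] \<and> x powi 1 = u powi 0 * x" if "x \<in> G" for x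
      using that by simp
    then have "\<forall>x\<in>mspan G []. \<exists>m i y. m \<noteq> 0 \<and> y \<in> mspan G [] \<and> x powi m = u powi i * y"
      unfolding mspan.simps(1) by blast
    moreover have "mindep G [] \<and> set [] \<subseteq> H \<and> mspan G [] \<subseteq> mspan G [] \<and> u \<in> mspan G []"
      using True by simp
    ultimately show ?thesis by blast
  next
    case False
    have "u = u powi 1 * 1" by simp
    moreover have "u powi 1 * 1 \<in> mspan G [u]" using mult_subgroup_1[OF G] by (intro mspan_ConsI) simp
    ultimately have "u \<in> mspan G [u]" by simp
    moreover have "\<exists>m i y. m \<noteq> 0 \<and> y \<in> mspan G [] \<and> x powi m = u powi i * y"
      if x: "x \<in> mspan G [u]" for x
    proof -
      obtain k y where "y \<in> G" "x = u powi k * y" using x by auto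
      then have "(1::int) \<noteq> 0 \<and> y \<in> mspan G [] \<and> x powi 1 = u powi k * y" by simp
      then show ?thesis by blast
    qed
    moreover have "mindep G [u]" using tf[OF Nil.prems(3)] False by auto
    ultimately show ?thesis using mspan_tail[of G "[]" u] Nil.prems by (intro exI[of _ "[u]"]) auto
  qed
next
  case (Cons t ts)
  note nz = mult_subgroup_nz[OF H(1)]
  have t: "t \<in> H" "t \<noteq> 0" and u0: "u \<noteq> 0" using Cons.prems nz by auto
  have S: "mult_subgroup (mspan G ts)" and S': "mult_subgroup (mspan G (t # ts))"
    using Cons.prems(2) nz[of 0] by (intro mult_subgroup_mspan G; auto)+
  show ?case
  proof (cases "\<exists>k. k \<noteq> 0 \<and> u powi k \<in> mspan G (t # ts)")
    case False
    have "u powi 1 \<in> mspan G (u # t # ts)" by (rule mspan_head[OF S'])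
    then have "u \<in> mspan G (u # t # ts)" by (simp del: mspan.simps)
    moreover have "\<exists>m i y. m \<noteq> 0 \<and> y \<in> mspan G (t # ts) \<and> x powi m = u powi i * y"
      if x: "x \<in> mspan G (u # t # ts)" for x
    proof -
      obtain k y where "y \<in> mspan G (t # ts)" "x = u powi k * y"
        using x unfolding mspan.simps(2)[of G u] by blast
      then have "(1::int) \<noteq> 0 \<and> y \<in> mspan G (t # ts) \<and> x powi 1 = u powi k * y" by simp
      then show ?thesis by blast
    qed
    moreover have "mindep G (u # t # ts)"
      using False Cons.prems unfolding mindep.simps(2)[of G u] by blast
    moreover have "set (u # t # ts) \<subseteq> H" using Cons.prems by simp
    ultimately show ?thesis
      using mspan_tail[of G "t # ts" u] by blast
  next
    case True
    then obtain k where k: "k \<noteq> 0" "u powi k \<in> mspan G (t # ts)" by blast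
    then obtain j z where z: "z \<in> mspan G ts" "u powi k = t powi j * z" by auto
    define g where "g = gcd k j"
    have g: "g \<noteq> 0" using k by (simp add: g_def)
    obtain k' j' where kj: "k = k' * g" "j = j' * g" "coprime k' j'"
      using gcd_coprime_exists[of k j] g unfolding g_def by blast
    \<comment> \<open>The exponent matrix with rows \<open>(k', - j')\<close> and
      \<open>(q, p)\<close> has determinant \<open>1\<close>, so \<open>u\<close> and
      \<open>t\<close> are monomials in \<open>v\<close> and \<open>w\<close> in turn. The first row
      is chosen so that \<open>v powi g = z\<close>.\<close>
    obtain p q where pq: "p * k' + q * j' = 1"
      using bezout_int[of k' j'] kj(3) by (auto simp: coprime_iff_gcd_eq_1)
    define v where "v = u powi k' * t powi (- j')"
    define w where "w = u powi q * t powi p"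
    have vw: "v \<in> H" "w \<in> H" "v \<noteq> 0" "w \<noteq> 0"
      using Cons.prems(3) t nz unfolding v_def w_def
      by (auto intro!: mult_subgroup_mult[OF H(1)] mult_subgroup_power_int[OF H(1)])
    have pw: "v powi a * w powi b = u powi (k' * a + q * b) * t powi (p * b - j' * a)" for a b
    proof -
      have "v powi a * w powi b =
          (u powi (k' * a) * u powi (q * b)) * (t powi ((- j') * a) * t powi (p * b))"
        unfolding v_def w_def power_int_mult_distrib power_int_mult by (simp only: mult_ac)
      also have "\<dots> = u powi (k' * a + q * b) * t powi ((- j') * a + p * b)"
        using t(2) u0 by (simp only: power_int_add simp_thms)
      also have "(- j') * a + p * b = p * b - j' * a" by simp
      finally show ?thesis .
    qed
    have vg: "v powi g \<in> mspan G ts"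
    proof -
      have "v powi g = u powi k * t powi (- j)"
        using pw[of g 0] by (simp add: kj)
      also have "\<dots> = z" using t by (simp add: z power_int_minus)
      finally show ?thesis using z by simp
    qed
    have u_eq: "u = v powi p * w powi j'" using pw[of p j'] pq by (simp add: algebra_simps)
    have t_eq: "t powi n = v powi (- q * n) * w powi (k' * n)" for n
    proof -
      have "k' * (- q * n) + q * (k' * n) = 0" "p * (k' * n) - j' * (- q * n) = n * (p * k' + q * j')"
        by (simp_all add: algebra_simps)
      then show ?thesis using pw[of "- q * n" "k' * n"] pq by simp
    qed
    obtain ts1 where ts1: "mindep G ts1" "set ts1 \<subseteq> H" "mspan G ts \<subseteq> mspan G ts1" "v \<in> mspan G ts1"
      and roots: "\<And>x. x \<in> mspan G ts1 \<Longrightarrow> \<exists>m i y. m \<noteq> 0 \<and> y \<in> mspan G ts \<and> x powi m = v powi i * y"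
      using Cons.IH[of v] Cons.prems vw by auto
    have S1: "mult_subgroup (mspan G ts1)"
      using ts1(2) nz[of 0] by (intro mult_subgroup_mspan G) auto
    have S1': "mult_subgroup (mspan G (w # ts1))"
      using ts1(2) vw nz[of 0] by (intro mult_subgroup_mspan G) auto
    have vS: "v \<in> mspan G (w # ts1)" using ts1(4) mspan_tail by blast
    have wS: "w powi n \<in> mspan G (w # ts1)" for n by (rule mspan_head[OF S1])
    \<comment> \<open>The last conjunct of the induction hypothesis says that passing to
      \<open>ts1\<close> adds, up to roots, only powers of \<open>v\<close>. A relation for
      \<open>w\<close> therefore puts a nonzero power of \<open>w\<close> into
      \<open>mspan G ts\<close>; since \<open>v powi g\<close> is there too, so is a nonzero power
      of \<open>t\<close>.\<close>
    have "w powi n \<notin> mspan G ts1" if n: "n \<noteq> 0" for n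
    proof
      assume "w powi n \<in> mspan G ts1"
      then obtain m i y where m: "m \<noteq> 0" "y \<in> mspan G ts" "(w powi n) powi m = v powi i * y"
        using roots by blast
      have "w powi (n * m * g) = (v powi i * y) powi g"
        by (simp only: power_int_mult m)
      also have "\<dots> = (v powi g) powi i * y powi g"
        by (simp add: power_int_mult_distrib mult.commute flip: power_int_mult)
      finally have wS: "w powi (n * m * g) \<in> mspan G ts"
        using vg m(2) S by (simp add: mult_subgroup_mult mult_subgroup_power_int)
      have "t powi (n * m * g) = (v powi g) powi (- q * n * m) * (w powi (n * m * g)) powi k'"
        unfolding t_eq by (simp add: mult_ac flip: power_int_mult)
      then have "t powi (n * m * g) \<in> mspan G ts"
        using wS vg S by (simp add: mult_subgroup_mult mult_subgroup_power_int)
      then show False using Cons.prems(1) n m(1) g by auto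
    qed
    then have "mindep G (w # ts1)" using ts1 by simp
    moreover have "mspan G (t # ts) \<subseteq> mspan G (w # ts1)"
    proof
      fix x assume "x \<in> mspan G (t # ts)"
      then obtain a y where "y \<in> mspan G ts" "x = t powi a * y" by auto
      moreover have "y \<in> mspan G (w # ts1)" using calculation ts1(3) mspan_tail by blast
      ultimately show "x \<in> mspan G (w # ts1)"
        unfolding t_eq using vS wS[of 1]
        by (auto intro!: mult_subgroup_mult[OF S1'] mult_subgroup_power_int[OF S1'] simp del: mspan.simps)
    qed
    moreover have "u \<in> mspan G (w # ts1)"
      by (subst u_eq) (intro mult_subgroup_mult[OF S1'] mult_subgroup_power_int[OF S1'] vS wS)
    moreover have "\<exists>m i y. m \<noteq> 0 \<and> y \<in> mspan G (t # ts) \<and> x powi m = u powi i * y"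
      if x: "x \<in> mspan G (w # ts1)" for x
    proof -
      obtain n x1 where x1: "x1 \<in> mspan G ts1" "x = w powi n * x1" using x by auto
      obtain m i y where m: "m \<noteq> 0" "y \<in> mspan G ts" "x1 powi m = v powi i * y" using roots x1 by blast
      have "x powi m = (v powi i * w powi (n * m)) * y"
        unfolding x1(2) power_int_mult_distrib m(3) power_int_mult by (simp only: mult_ac)
      also have "\<dots> = u powi (k' * i + q * (n * m)) * (t powi (p * (n * m) - j' * i) * y)"
        unfolding pw by (simp add: mult_ac)
      finally show ?thesis using m mspan_ConsI by blast
    qed
    moreover have "set (w # ts1) \<subseteq> H" using ts1 vw by simp
    ultimately show ?thesis by blast
  qed
qed

lemma exists_mindep_mspan:
  assumes G: "mult_subgroup G" and H: "mult_subgroup H" "G \<subseteq> H"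
    and tf: "\<And>a k. a \<in> H \<Longrightarrow> k \<noteq> 0 \<Longrightarrow> a powi k \<in> G \<Longrightarrow> a \<in> G"
    and "finite S" "S \<subseteq> H"
  shows "\<exists>ts. mindep G ts \<and> set ts \<subseteq> H \<and> S \<subseteq> mspan G ts"
  using assms(5,6)
proof (induction S)
  case empty
  show ?case by (intro exI[of _ "[]"]) simp
next
  case (insert u S)
  then obtain ts where ts: "mindep G ts" "set ts \<subseteq> H" "S \<subseteq> mspan G ts" by auto
  have "\<exists>ts'. mindep G ts' \<and> set ts' \<subseteq> H \<and> mspan G ts \<subseteq> mspan G ts' \<and> u \<in> mspan G ts' \<and>
    (\<forall>x\<in>mspan G ts'. \<exists>m i y. m \<noteq> 0 \<and> y \<in> mspan G ts \<and> x powi m = u powi i * y)"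
    using insert.prems by (intro mindep_extend[OF G H tf ts(1,2)]) auto
  then show ?case using ts(3) by blast
qed

section \<open>Integral elements are in the homogeneous quotient field\<close>

locale torsionless_graded_domain =
  fixes R :: "'k::field set" and Rg :: "'g::cancel_comm_monoid_add \<Rightarrow> 'k set"
  assumes torsion_free: "torsion_free_quotient TYPE('g)"
    and graded: "graded_domain R Rg"
begin

lemma R_subring: "is_subring R"
  using graded unfolding graded_domain_def is_subring_def by simp

lemma Rg_0: "0 \<in> Rg \<alpha>"
  and Rg_R: "x \<in> Rg \<alpha> \<Longrightarrow> x \<in> R"
  and Rg_diff: "x \<in> Rg \<alpha> \<Longrightarrow> y \<in> Rg \<alpha> \<Longrightarrow> x - y \<in> Rg \<alpha>"
  and Rg_mult: "x \<in> Rg \<alpha> \<Longrightarrow> y \<in> Rg \<beta> \<Longrightarrow> x * y \<in> Rg (\<alpha> + \<beta>)"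
  and K_fraction: "\<exists>a\<in>R. \<exists>b\<in>R. b \<noteq> 0 \<and> z = a / b"
  using graded unfolding graded_domain_def by blast+

lemma Rg_add: "x \<in> Rg \<alpha> \<Longrightarrow> y \<in> Rg \<alpha> \<Longrightarrow> x + y \<in> Rg \<alpha>"
  using Rg_diff[of x \<alpha> "0 - y"] Rg_diff[of 0 \<alpha> y] Rg_0 by simp

lemma Rg_sum: "(\<And>i. i \<in> I \<Longrightarrow> f i \<in> Rg \<alpha>) \<Longrightarrow> sum f I \<in> Rg \<alpha>"
  by (induction I rule: infinite_finite_induct) (auto simp: Rg_0 Rg_add)

lemma ex1_decomposition:
  "r \<in> R \<Longrightarrow> \<exists>!c. finite {\<alpha>. c \<alpha> \<noteq> 0} \<and> (\<forall>\<alpha>. c \<alpha> \<in> Rg \<alpha>) \<and> r = sum c {\<alpha>. c \<alpha> \<noteq> 0}"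
  using graded unfolding graded_domain_def by (elim conjE) (rule bspec)

lemma
  assumes "r \<in> R"
  shows finite_comp: "finite {\<alpha>. comp Rg r \<alpha> \<noteq> 0}"
    and comp_in: "comp Rg r \<alpha> \<in> Rg \<alpha>"
    and sum_comp: "(\<Sum>\<alpha> | comp Rg r \<alpha> \<noteq> 0. comp Rg r \<alpha>) = r"
  using theI'[OF ex1_decomposition[OF assms]] unfolding comp_def[symmetric] by auto

lemma comp_eqI:
  assumes "finite S" "\<And>\<alpha>. c \<alpha> \<in> Rg \<alpha>" "\<And>\<alpha>. \<alpha> \<notin> S \<Longrightarrow> c \<alpha> = 0" "r = sum c S"
  shows "comp Rg r = c"
proof -
  have "{\<alpha>. c \<alpha> \<noteq> 0} \<subseteq> S" using assms(3) by auto
  then have "finite {\<alpha>. c \<alpha> \<noteq> 0}" "sum c {\<alpha>. c \<alpha> \<noteq> 0} = sum c S"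
    using assms(1) by (auto intro: finite_subset sum.mono_neutral_left)
  moreover have "r \<in> R" using assms(2,4) Rg_R by (auto intro!: subring_sum[OF R_subring])
  ultimately show ?thesis
    unfolding comp_def by (intro the1_equality ex1_decomposition) (use assms in auto)
qed

lemma sum_comp_superset:
  "r \<in> R \<Longrightarrow> finite S \<Longrightarrow> {\<alpha>. comp Rg r \<alpha> \<noteq> 0} \<subseteq> S \<Longrightarrow> (\<Sum>\<alpha>\<in>S. comp Rg r \<alpha>) = r"
  by (subst (2) sum_comp[symmetric], assumption) (rule sum.mono_neutral_right, auto)

lemma comp_homogeneous: "x \<in> Rg \<alpha> \<Longrightarrow> comp Rg x \<beta> = (if \<beta> = \<alpha> then x else 0)"
  by (subst comp_eqI[of "{\<alpha>}" "\<lambda>\<beta>. if \<beta> = \<alpha> then x else 0"]) (auto simp: Rg_0)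

lemma comp_0 [simp]: "comp Rg 0 \<alpha> = 0"
  using comp_homogeneous[OF Rg_0] by simp

lemma comp_add:
  assumes "r \<in> R" "s \<in> R"
  shows "comp Rg (r + s) \<alpha> = comp Rg r \<alpha> + comp Rg s \<alpha>"
proof -
  define S where "S = {\<alpha>. comp Rg r \<alpha> \<noteq> 0} \<union> {\<alpha>. comp Rg s \<alpha> \<noteq> 0}"
  have "finite S" using assms finite_comp by (simp add: S_def)
  then have "comp Rg (r + s) = (\<lambda>\<alpha>. comp Rg r \<alpha> + comp Rg s \<alpha>)"
    using assms
    by (intro comp_eqI[of S]) (auto simp: S_def Rg_add comp_in sum.distrib sum_comp_superset)
  then show ?thesis by simp
qed

lemma comp_sum:
  assumes "\<And>i. i \<in> I \<Longrightarrow> f i \<in> R"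
  shows "comp Rg (sum f I) \<alpha> = (\<Sum>i\<in>I. comp Rg (f i) \<alpha>)"
  using assms
proof (induction I rule: infinite_finite_induct)
  case (insert i I)
  then show ?case by (simp add: comp_add subring_sum[OF R_subring])
qed auto

lemma eq_0_if_comp: "r \<in> R \<Longrightarrow> (\<And>\<alpha>. comp Rg r \<alpha> = 0) \<Longrightarrow> r = 0"
  using sum_comp[of r] by simp

lemma degree_unique: "x \<in> Rg \<alpha> \<Longrightarrow> x \<in> Rg \<beta> \<Longrightarrow> x \<noteq> 0 \<Longrightarrow> \<alpha> = \<beta>"
  using comp_homogeneous[of x \<alpha> \<beta>] comp_homogeneous[of x \<beta> \<beta>] by (auto split: if_splits)

lemma comp_mult:
  assumes r: "r \<in> R" "finite S" "{\<alpha>. comp Rg r \<alpha> \<noteq> 0} \<subseteq> S"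
    and s: "s \<in> R" "finite T" "{\<alpha>. comp Rg s \<alpha> \<noteq> 0} \<subseteq> T"
  shows "comp Rg (r * s) \<gamma> =
    (\<Sum>(\<alpha>, \<beta>)\<in>S \<times> T. if \<alpha> + \<beta> = \<gamma> then comp Rg r \<alpha> * comp Rg s \<beta> else 0)"
proof -
  have "r * s = (\<Sum>\<alpha>\<in>S. comp Rg r \<alpha>) * (\<Sum>\<beta>\<in>T. comp Rg s \<beta>)"
    using r s by (simp add: sum_comp_superset)
  also have "\<dots> = (\<Sum>(\<alpha>, \<beta>)\<in>S \<times> T. comp Rg r \<alpha> * comp Rg s \<beta>)"
    by (simp add: sum_product sum.cartesian_product)
  finally have "comp Rg (r * s) \<gamma> = (\<Sum>p\<in>S \<times> T. comp Rg (case p of (\<alpha>, \<beta>) \<Rightarrow> comp Rg r \<alpha> * comp Rg s \<beta>) \<gamma>)"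
    using comp_in[OF r(1)] comp_in[OF s(1)] Rg_R
    by (auto intro!: comp_sum subring_mult[OF R_subring])
  also have "\<dots> = (\<Sum>(\<alpha>, \<beta>)\<in>S \<times> T. if \<alpha> + \<beta> = \<gamma> then comp Rg r \<alpha> * comp Rg s \<beta> else 0)"
    using comp_homogeneous[OF Rg_mult[OF comp_in[OF r(1)] comp_in[OF s(1)]]]
    by (intro sum.cong) auto
  finally show ?thesis .
qed

lemma comp_mult_homogeneous:
  assumes r: "r \<in> R" and h: "h \<in> Rg \<beta>"
  shows "comp Rg (r * h) (\<alpha> + \<beta>) = comp Rg r \<alpha> * h"
proof -
  define S where "S = insert \<alpha> {\<alpha>. comp Rg r \<alpha> \<noteq> 0}"
  have S: "finite S" using finite_comp[OF r] by (simp add: S_def)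
  have "comp Rg (r * h) (\<alpha> + \<beta>) =
    (\<Sum>(a, b)\<in>S \<times> {\<beta>}. if a + b = \<alpha> + \<beta> then comp Rg r a * comp Rg h b else 0)"
    by (rule comp_mult) (use r h Rg_R comp_homogeneous[OF h] S in \<open>auto simp: S_def\<close>)
  also have "S \<times> {\<beta>} = (\<lambda>a. (a, \<beta>)) ` S" by auto
  also have "(\<Sum>(a, b)\<in>(\<lambda>a. (a, \<beta>)) ` S. if a + b = \<alpha> + \<beta> then comp Rg r a * comp Rg h b else 0) =
      (\<Sum>a\<in>S. if a = \<alpha> then comp Rg r a * h else 0)"
    by (subst sum.reindex) (auto simp: inj_on_def comp_homogeneous[OF h] intro!: sum.cong)
  also have "\<dots> = comp Rg r \<alpha> * h" using S by (simp add: S_def)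
  finally show ?thesis .
qed

text \<open>The monoid has no subtraction, so the degree \<gamma> - \<beta> has to be found; a
  nonzero component of \<open>r * h\<close> supplies it.\<close>

lemma comp_mult_homogeneous_degree:
  assumes r: "r \<in> R" and h: "h \<in> Rg \<beta>" and "comp Rg (r * h) \<gamma> \<noteq> 0"
  obtains \<alpha> where "\<gamma> = \<alpha> + \<beta>"
proof (cases "\<exists>\<alpha>. \<gamma> = \<alpha> + \<beta>")
  case True then show ?thesis using that by auto
next
  case False
  define S where "S = {\<alpha>. comp Rg r \<alpha> \<noteq> 0}"
  have S: "finite S" using finite_comp[OF r] by (simp add: S_def)
  have "comp Rg (r * h) \<gamma> =
    (\<Sum>(a, b)\<in>S \<times> {\<beta>}. if a + b = \<gamma> then comp Rg r a * comp Rg h b else 0)"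
    by (rule comp_mult) (use r h Rg_R comp_homogeneous[OF h] S in \<open>auto simp: S_def\<close>)
  also have "\<dots> = 0" using False by (intro sum.neutral) auto
  finally show ?thesis using assms by simp
qed

text \<open>The axioms do not place \<open>1\<close> in degree \<open>0\<close>. For a nonzero
  component \<open>x\<close> of \<open>1\<close>, the component of \<open>1 * x\<close> in the
  degree of \<open>x\<close> shows that the degree-zero component of \<open>1\<close> fixes
  \<open>x\<close>, hence equals \<open>1\<close>.\<close>

lemma one_homogeneous: "1 \<in> Rg 0"
proof -
  have 1: "1 \<in> R" using R_subring by (rule subring_1)
  obtain \<alpha> where \<alpha>: "comp Rg 1 \<alpha> \<noteq> 0" using eq_0_if_comp[OF 1] by auto
  define x where "x = comp Rg 1 \<alpha>"
  have x: "x \<in> Rg \<alpha>" "x \<noteq> 0" using comp_in[OF 1] \<alpha> by (auto simp: x_def)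
  have "comp Rg 1 0 * x = comp Rg (1 * x) (0 + \<alpha>)" using comp_mult_homogeneous[OF 1 x(1), of 0] by simp
  also have "\<dots> = x" using comp_homogeneous[OF x(1)] by simp
  finally have "comp Rg 1 0 = 1" using x by simp
  then show ?thesis using comp_in[OF 1, of 0] by simp
qed

lemma homogI: "x \<in> Rg \<alpha> \<Longrightarrow> x \<noteq> 0 \<Longrightarrow> x \<in> homog Rg"
  unfolding homog_def by blast

lemma homogE:
  assumes "x \<in> homog Rg"
  obtains \<alpha> where "x \<in> Rg \<alpha>" "x \<noteq> 0" "x \<in> R"
  using assms Rg_R unfolding homog_def by blast

lemma homog_1: "1 \<in> homog Rg"
  using homogI[OF one_homogeneous] by simp

lemma homog_mult: "x \<in> homog Rg \<Longrightarrow> y \<in> homog Rg \<Longrightarrow> x * y \<in> homog Rg"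
  by (metis homogE homogI Rg_mult mult_eq_0_iff)

lemma homog_power: "x \<in> homog Rg \<Longrightarrow> x ^ n \<in> homog Rg"
  by (induction n) (auto simp: homog_1 homog_mult)

lemma Rg_power: "x \<in> Rg \<alpha> \<Longrightarrow> x ^ n \<in> Rg (nsum n \<alpha>)"
  by (induction n) (auto simp: one_homogeneous nsum_Suc Rg_mult add.commute)

lemma homog_R: "x \<in> homog Rg \<Longrightarrow> x \<in> R" and homog_nz: "x \<in> homog Rg \<Longrightarrow> x \<noteq> 0"
  by (auto elim: homogE)

lemma RHI: "r \<in> R \<Longrightarrow> h \<in> homog Rg \<Longrightarrow> r / h \<in> RH R Rg"
  unfolding RH_def by blast

lemma RHE:
  assumes "x \<in> RH R Rg"
  obtains r h where "r \<in> R" "h \<in> homog Rg" "x = r / h"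
  using assms unfolding RH_def by blast

lemma RH_incl: "R \<subseteq> RH R Rg"
  using RHI[OF _ homog_1] by force

lemma common_denominator:
  assumes "finite I" "\<And>i. i \<in> I \<Longrightarrow> f i \<in> RH R Rg"
  shows "\<exists>h\<in>homog Rg. \<forall>i\<in>I. h * f i \<in> R"
  using assms
proof (induction I)
  case empty
  then show ?case using homog_1 by auto
next
  case (insert i I)
  then obtain h where h: "h \<in> homog Rg" "\<And>j. j \<in> I \<Longrightarrow> h * f j \<in> R" by auto
  obtain r k where rk: "r \<in> R" "k \<in> homog Rg" "f i = r / k" using insert.prems[of i] RHE by auto
  have "(k * h) * f j \<in> R" if "j \<in> insert i I" for j
  proof (cases "j = i")
    case True
    then have "(k * h) * f j = h * r" using rk homog_nz by simp
    moreover have "h * r \<in> R" using h(1) rk(1) homog_R by (intro subring_mult[OF R_subring])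
    ultimately show ?thesis by (simp only:)
  next
    case False
    then show ?thesis
      using h(2)[of j] that rk homog_R by (simp add: mult.assoc subring_mult[OF R_subring])
  qed
  then show ?case using rk h homog_mult by blast
qed

lemma common_denominator_poly:
  assumes "f \<in> polys_over (RH R Rg)"
  obtains h where "h \<in> homog Rg" "smult h f \<in> polys_over R"
proof -
  obtain h where h: "h \<in> homog Rg" "\<forall>i\<in>{..degree f}. h * coeff f i \<in> R"
    using common_denominator[of "{..degree f}" "coeff f"] assms by (auto simp: coeff_in)
  have "h * coeff f i \<in> R" for i
    using h R_subring by (cases "i \<le> degree f") (auto simp: coeff_eq_0 subring_0)
  then show ?thesis using h that by (auto simp: polys_over_def)
qed

text \<open>The set of components may or may not contain \<open>0\<close>, depending on the representation and on whether
  the monoid is trivial, so all statements are up to \<open>0\<close>.\<close>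

lemma compsH_memI: "r \<in> R \<Longrightarrow> h \<in> homog Rg \<Longrightarrow> comp Rg r \<alpha> / h \<in> compsH R Rg (r / h)"
  unfolding compsH_def by blast

text \<open>Independence of the representation: \<open>r * h' = r' * h\<close> is compared in a
  single degree, and \<open>y \<noteq> 0\<close> guarantees that this degree occurs on the other
  side.\<close>

lemma compsH_memE:
  assumes "y \<in> compsH R Rg (r / h)" "r \<in> R" "h \<in> homog Rg" "y \<noteq> 0"
  obtains \<alpha> where "y = comp Rg r \<alpha> / h"
proof -
  obtain r' h' \<alpha>' where *: "r' \<in> R" "h' \<in> homog Rg" "r / h = r' / h'" "y = comp Rg r' \<alpha>' / h'"
    using assms(1) unfolding compsH_def by blast
  obtain \<beta> where \<beta>: "h \<in> Rg \<beta>" "h \<noteq> 0" using assms(3) homogE by blast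
  obtain \<beta>' where \<beta>': "h' \<in> Rg \<beta>'" "h' \<noteq> 0" using *(2) homogE by blast
  have eq: "r * h' = r' * h" using *(3) \<beta> \<beta>' by (simp add: frac_eq_eq)
  have c: "comp Rg (r * h') (\<alpha>' + \<beta>) = comp Rg r' \<alpha>' * h"
    unfolding eq using comp_mult_homogeneous *(1) \<beta>(1) by blast
  moreover have "comp Rg r' \<alpha>' * h \<noteq> 0" using *(4) \<open>y \<noteq> 0\<close> \<beta> by auto
  ultimately obtain \<alpha> where \<alpha>: "\<alpha>' + \<beta> = \<alpha> + \<beta>'"
    using comp_mult_homogeneous_degree[OF assms(2) \<beta>'(1)] by metis
  then have "comp Rg r \<alpha> * h' = comp Rg r' \<alpha>' * h"
    using c comp_mult_homogeneous[OF assms(2) \<beta>'(1), of \<alpha>] by simp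
  then have "y = comp Rg r \<alpha> / h" using *(4) \<beta>(2) \<beta>'(2) by (simp add: frac_eq_eq)
  then show ?thesis using that by blast
qed

section \<open>Homogeneous units and the subrings of R_H supported on them\<close>

definition unitsH :: "'k set" where
  "unitsH = {a / b | a b. a \<in> homog Rg \<and> b \<in> homog Rg}"

text \<open>The homogeneous units of degree zero. The quotient of \<open>unitsH\<close> by this
  group replaces the degree group, so that no grading of R_H by the quotient group of the monoid has
  to be set up.\<close>

definition units0 :: "'k set" where
  "units0 = {a / b | a b \<alpha>. a \<in> Rg \<alpha> \<and> b \<in> Rg \<alpha> \<and> a \<noteq> 0 \<and> b \<noteq> 0}"

lemma units0I: "a \<in> Rg \<alpha> \<Longrightarrow> b \<in> Rg \<alpha> \<Longrightarrow> a \<noteq> 0 \<Longrightarrow> b \<noteq> 0 \<Longrightarrow> a / b \<in> units0"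
  unfolding units0_def by blast

lemma unitsHI: "a \<in> homog Rg \<Longrightarrow> b \<in> homog Rg \<Longrightarrow> a / b \<in> unitsH"
  unfolding unitsH_def by blast

lemma mult_subgroup_unitsH: "mult_subgroup unitsH"
  unfolding mult_subgroup_def
proof (intro conjI ballI)
  show "0 \<notin> unitsH" unfolding unitsH_def using homog_nz[of 0] by auto
  show "1 \<in> unitsH" using unitsHI[OF homog_1 homog_1] by simp
  fix x assume "x \<in> unitsH"
  then obtain a b where a: "a \<in> homog Rg" "b \<in> homog Rg" "x = a / b" unfolding unitsH_def by blast
  then show "inverse x \<in> unitsH" using unitsHI by simp
  fix y assume "y \<in> unitsH"
  then obtain c d where c: "c \<in> homog Rg" "d \<in> homog Rg" "y = c / d" unfolding unitsH_def by blast
  have "x * y = (a * c) / (b * d)" by (simp add: a c)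
  then show "x * y \<in> unitsH" using a c unitsHI homog_mult by metis
qed

lemma mult_subgroup_units0: "mult_subgroup units0"
  unfolding mult_subgroup_def
proof (intro conjI ballI)
  show "0 \<notin> units0" unfolding units0_def by auto
  show "1 \<in> units0" using units0I[OF one_homogeneous one_homogeneous] by simp
  fix x assume "x \<in> units0"
  then obtain a b \<alpha> where a: "a \<in> Rg \<alpha>" "b \<in> Rg \<alpha>" "a \<noteq> 0" "b \<noteq> 0" "x = a / b" unfolding units0_def by blast
  then show "inverse x \<in> units0" using units0I by simp
  fix y assume "y \<in> units0"
  then obtain c d \<beta> where c: "c \<in> Rg \<beta>" "d \<in> Rg \<beta>" "c \<noteq> 0" "d \<noteq> 0" "y = c / d" unfolding units0_def by blast
  have "x * y = (a * c) / (b * d)" by (simp add: a c)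
  then show "x * y \<in> units0" using units0I[of "a * c" "\<alpha> + \<beta>" "b * d"] a c Rg_mult by simp
qed

lemma units0_incl: "units0 \<subseteq> unitsH"
  unfolding units0_def using unitsHI homogI by blast

text \<open>If \<open>u = a / b\<close> and a power of \<open>u\<close> has degree zero, then equal
  positive multiples of the degrees of \<open>a\<close> and \<open>b\<close> agree, and so do the
  degrees. This is the hypothesis under which bases modulo \<open>units0\<close> exist.\<close>

lemma unitsH_torsion_free:
  assumes u: "u \<in> unitsH" and k: "k \<noteq> 0" "u powi k \<in> units0"
  shows "u \<in> units0"
proof -
  define n where "n = nat \<bar>k\<bar>"
  have n: "n > 0" using k by (simp add: n_def)
  have "u ^ n \<in> units0"
  proof (cases "k > 0")
    case True
    then show ?thesis using k by (simp add: n_def power_int_def)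
  next
    case False
    then have "u powi k = inverse (u ^ n)" using k by (simp add: n_def power_int_def power_inverse)
    then show ?thesis using mult_subgroup_inverse[OF mult_subgroup_units0 k(2)] by simp
  qed
  then obtain c d \<gamma> where c: "c \<in> Rg \<gamma>" "d \<in> Rg \<gamma>" "c \<noteq> 0" "d \<noteq> 0" "u ^ n = c / d" unfolding units0_def by blast
  obtain a b where ab: "a \<in> homog Rg" "b \<in> homog Rg" "u = a / b" using u unfolding unitsH_def by blast
  obtain \<alpha> where \<alpha>: "a \<in> Rg \<alpha>" "a \<noteq> 0" using ab homogE by blast
  obtain \<beta> where \<beta>: "b \<in> Rg \<beta>" "b \<noteq> 0" using ab homogE by blast
  have "a ^ n * d = c * b ^ n" using c \<beta> ab by (simp add: power_divide frac_eq_eq)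
  moreover have "a ^ n * d \<in> Rg (nsum n \<alpha> + \<gamma>)" "c * b ^ n \<in> Rg (\<gamma> + nsum n \<beta>)"
    using \<alpha> \<beta> c by (auto intro!: Rg_mult Rg_power)
  moreover have "a ^ n * d \<noteq> 0" using \<alpha> c by simp
  ultimately have "nsum n \<alpha> + \<gamma> = \<gamma> + nsum n \<beta>" using degree_unique by metis
  then have "nsum n \<alpha> = nsum n \<beta>" by (simp add: add.commute)
  then have "\<alpha> = \<beta>" using torsion_free n unfolding torsion_free_quotient_def nsum_def by blast
  then show ?thesis using \<alpha> \<beta> ab units0I by blast
qed

text \<open>For a group \<open>B\<close> between \<open>units0\<close> and \<open>unitsH\<close>
  this is the subring of R_H formed by the homogeneous parts whose degrees occur in
  \<open>B\<close>.\<close>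

definition part :: "'k set \<Rightarrow> 'k set" where
  "part B = {x \<in> RH R Rg. compsH R Rg x \<subseteq> insert 0 B}"

lemma part_iff:
  assumes "r \<in> R" "h \<in> homog Rg"
  shows "r / h \<in> part B \<longleftrightarrow> (\<forall>\<alpha>. comp Rg r \<alpha> / h \<in> insert 0 B)"
  using assms RHI compsH_memI compsH_memE unfolding part_def by blast

text \<open>Nonzero elements of one degree differ by factors in \<open>units0\<close>, hence in
  \<open>B\<close>: a nonzero sum inherits the membership from any nonzero summand.\<close>

lemma homogeneous_sum_in:
  assumes B: "mult_subgroup B" "units0 \<subseteq> B"
    and p: "\<And>i. i \<in> I \<Longrightarrow> p i \<in> Rg \<gamma> \<and> p i / h \<in> insert 0 B"
  shows "sum p I / h \<in> insert 0 B"
  using p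
proof (induction I rule: infinite_finite_induct)
  case (insert i I)
  define s where "s = sum p I"
  have s: "s / h \<in> insert 0 B" "s \<in> Rg \<gamma>" using insert unfolding s_def by (auto intro: Rg_sum)
  have pi: "p i \<in> Rg \<gamma>" "p i / h \<in> insert 0 B" using insert.prems by auto
  have "(p i + s) / h \<in> insert 0 B"
  proof (cases "p i = 0 \<or> p i + s = 0 \<or> h = 0")
    case True
    then show ?thesis using s by auto
  next
    case False
    then have "(p i + s) / p i \<in> B" using B(2) units0I[of "p i + s" \<gamma> "p i"] Rg_add pi s by auto
    moreover have "p i / h \<in> B" using pi False by auto
    ultimately have "((p i + s) / p i) * (p i / h) \<in> B" using B by (intro mult_subgroup_mult)
    then show ?thesis using False by simp
  qed
  then show ?case using insert.hyps by (simp add: s_def)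
qed auto

lemma is_subring_part:
  assumes B: "mult_subgroup B" "units0 \<subseteq> B"
  shows "is_subring (part B)"
proof -
  have add: "x + y \<in> part B" if x: "x \<in> part B" and y: "y \<in> part B" for x y
  proof -
    obtain r h where r: "r \<in> R" "h \<in> homog Rg" "x = r / h" using x RHE unfolding part_def by blast
    obtain s k where s: "s \<in> R" "k \<in> homog Rg" "y = s / k" using y RHE unfolding part_def by blast
    have hk: "h * k \<in> homog Rg" "r * k \<in> R" "s * h \<in> R"
      using r s by (auto simp: homog_mult homog_R subring_mult[OF R_subring])
    have nz: "h \<noteq> 0" "k \<noteq> 0" using r s homog_nz by auto
    have e: "x = (r * k) / (h * k)" "y = (s * h) / (h * k)" using nz r s by simp_all
    have px: "comp Rg (r * k) \<gamma> / (h * k) \<in> insert 0 B" and py: "comp Rg (s * h) \<gamma> / (h * k) \<in> insert 0 B" for \<gamma>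
      using part_iff hk x y unfolding e by blast+
    have "comp Rg (r * k + s * h) \<gamma> / (h * k) \<in> insert 0 B" for \<gamma>
    proof -
      \<comment> \<open>Addition of two elements is written as a sum over the two truth values to
        reuse the lemma on homogeneous sums.\<close>
      have "sum (\<lambda>b. if b then comp Rg (r * k) \<gamma> else comp Rg (s * h) \<gamma>) UNIV / (h * k) \<in> insert 0 B"
        using px py hk comp_in by (intro homogeneous_sum_in[OF B, of _ _ \<gamma>]) auto
      then show ?thesis by (simp add: UNIV_bool comp_add hk add.commute)
    qed
    moreover have "x + y = (r * k + s * h) / (h * k)" unfolding e by (simp only: add_divide_distrib)
    ultimately show ?thesis using part_iff hk subring_add[OF R_subring] by metis
  qed
  have mult: "x * y \<in> part B" if x: "x \<in> part B" and y: "y \<in> part B" for x y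
  proof -
    obtain r h where r: "r \<in> R" "h \<in> homog Rg" "x = r / h" using x RHE unfolding part_def by blast
    obtain s k where s: "s \<in> R" "k \<in> homog Rg" "y = s / k" using y RHE unfolding part_def by blast
    have hk: "h * k \<in> homog Rg" "r * s \<in> R"
      using r s by (auto simp: homog_mult subring_mult[OF R_subring])
    have px: "comp Rg r \<gamma> / h \<in> insert 0 B" and py: "comp Rg s \<gamma> / k \<in> insert 0 B" for \<gamma>
      using part_iff r s x y by blast+
    have "comp Rg (r * s) \<gamma> / (h * k) \<in> insert 0 B" for \<gamma>
      unfolding comp_mult[OF r(1) finite_comp[OF r(1)] order_refl s(1) finite_comp[OF s(1)] order_refl]
    proof (rule homogeneous_sum_in[OF B, of _ _ \<gamma>], clarify)
      fix \<alpha> \<beta>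
      have "(comp Rg r \<alpha> / h) * (comp Rg s \<beta> / k) \<in> insert 0 B"
        using px[of \<alpha>] py[of \<beta>] mult_subgroup_mult[OF B(1)] by force
      then show "(if \<alpha> + \<beta> = \<gamma> then comp Rg r \<alpha> * comp Rg s \<beta> else 0) \<in> Rg \<gamma> \<and>
         (if \<alpha> + \<beta> = \<gamma> then comp Rg r \<alpha> * comp Rg s \<beta> else 0) / (h * k) \<in> insert 0 B"
        using Rg_0 Rg_mult[OF comp_in[OF r(1), of \<alpha>] comp_in[OF s(1), of \<beta>]] by auto
    qed
    moreover have "x * y = (r * s) / (h * k)" using r s by simp
    ultimately show ?thesis using part_iff hk by metis
  qed
  have "0 / 1 \<in> part B" using part_iff[OF _ homog_1, of 0 B] R_subring by (simp add: subring_0)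
  moreover have one: "1 / 1 \<in> part B" "(- 1) / 1 \<in> part B"
    using part_iff[OF _ homog_1, of 1 B] part_iff[OF _ homog_1, of "- 1" B] R_subring one_homogeneous
      Rg_diff[OF Rg_0 one_homogeneous] B units0I[OF Rg_diff[OF Rg_0 one_homogeneous] one_homogeneous] mult_subgroup_1
    by (auto simp: subring_1 subring_uminus comp_homogeneous)
  moreover have "x - y \<in> part B" if "x \<in> part B" "y \<in> part B" for x y
    using add[OF that(1) mult[OF one(2) that(2)]] by simp
  ultimately show ?thesis unfolding is_subring_def using add mult by simp
qed

lemma part_RH: "part B \<subseteq> RH R Rg"
  unfolding part_def by blast

lemma part_mono: "B \<subseteq> C \<Longrightarrow> part B \<subseteq> part C"
  unfolding part_def by blast

lemma unit_in_part:
  assumes "u \<in> B" "u \<in> unitsH"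
  shows "u \<in> part B"
proof -
  obtain a b where ab: "a \<in> homog Rg" "b \<in> homog Rg" "u = a / b" using assms unfolding unitsH_def by blast
  obtain \<alpha> where "a \<in> Rg \<alpha>" using ab homogE by blast
  then have "comp Rg a \<gamma> / b \<in> insert 0 B" for \<gamma>
    using comp_homogeneous ab assms by auto
  then show ?thesis using part_iff ab homog_R by metis
qed

text \<open>The nonzero components of \<open>coeff P j * t ^ j\<close> lie in the coset of
  \<open>B\<close> given by \<open>t ^ j\<close>. No nonzero power of \<open>t\<close> is in
  \<open>B\<close>, so these cosets are disjoint and the terms of \<open>poly P t\<close> cannot
  cancel.\<close>

lemma transcendental_over_part:
  assumes B: "mult_subgroup B" "units0 \<subseteq> B" "B \<subseteq> unitsH"
    and t: "t \<in> unitsH" "\<And>k. k \<noteq> 0 \<Longrightarrow> t powi k \<notin> B"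
    and P: "P \<in> polys_over (part B)" "poly P t = 0"
  shows "P = 0"
proof -
  obtain a b where ab: "a \<in> homog Rg" "b \<in> homog Rg" "t = a / b" using t(1) unfolding unitsH_def by blast
  then have nz: "a \<noteq> 0" "b \<noteq> 0" "t \<noteq> 0" using homog_nz by auto
  define n where "n = degree P"
  have RH: "coeff P j * t ^ j \<in> RH R Rg" for j
  proof -
    obtain r h where "r \<in> R" "h \<in> homog Rg" "coeff P j = r / h"
      using coeff_in[OF P(1), of j] part_RH RHE by blast
    then have "coeff P j * t ^ j = (r * a ^ j) / (h * b ^ j)" "r * a ^ j \<in> R" "h * b ^ j \<in> homog Rg"
      using ab homog_R R_subring by (auto simp: power_divide homog_mult homog_power subring_mult subring_power)
    then show ?thesis using RHI by simp
  qed
  obtain h where h: "h \<in> homog Rg" "\<forall>j\<in>{..n}. h * (coeff P j * t ^ j) \<in> R"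
    using common_denominator[of "{..n}" "\<lambda>j. coeff P j * t ^ j"] RH by auto
  have h0: "h \<noteq> 0" using h homog_nz by auto
  \<comment> \<open>Scaling by the common denominator \<open>h\<close> moves all terms into
    \<open>R\<close>, where \<open>comp\<close> is additive.\<close>
  define r where "r j = h * (coeff P j * t ^ j)" for j
  have r: "r j \<in> R" if "j \<le> n" for j using h that by (simp add: r_def)
  have in_B: "comp Rg (r j) \<alpha> / (h * t ^ j) \<in> insert 0 B" if j: "j \<le> n" for j \<alpha>
  proof -
    obtain \<beta> where \<beta>: "b ^ j \<in> Rg \<beta>" using ab homog_power homogE by metis
    have hom: "h * a ^ j \<in> homog Rg" "r j * b ^ j \<in> R"
      using h ab r[OF j] homog_R homog_power homog_mult R_subring by (auto simp: subring_mult)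
    have "coeff P j = (r j * b ^ j) / (h * a ^ j)"
      using h0 nz by (simp add: r_def ab power_divide)
    then have "comp Rg (r j * b ^ j) (\<alpha> + \<beta>) / (h * a ^ j) \<in> insert 0 B"
      using coeff_in[OF P(1), of j] part_iff[OF hom(2,1)] by simp
    moreover have "comp Rg (r j * b ^ j) (\<alpha> + \<beta>) / (h * a ^ j) = comp Rg (r j) \<alpha> / (h * t ^ j)"
      using comp_mult_homogeneous[OF r[OF j] \<beta>] h0 nz by (simp add: ab power_divide)
    ultimately show ?thesis by simp
  qed
  \<comment> \<open>Components of \<open>r j\<close> and \<open>r k\<close> in the same degree have
    their quotient in \<open>units0\<close>; comparing their cosets would put
    \<open>t powi (k - j)\<close> into \<open>B\<close>.\<close>
  have disj: "j = k" if jk: "j \<le> n" "k \<le> n" "comp Rg (r j) \<alpha> \<noteq> 0" "comp Rg (r k) \<alpha> \<noteq> 0" for j k \<alpha>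
  proof (rule ccontr)
    assume ne: "j \<noteq> k"
    have "comp Rg (r j) \<alpha> / (h * t ^ j) \<in> B" "comp Rg (r k) \<alpha> / (h * t ^ k) \<in> B"
      using in_B jk h0 nz by auto
    moreover have "comp Rg (r k) \<alpha> / comp Rg (r j) \<alpha> \<in> B"
      using units0I[of "comp Rg (r k) \<alpha>" \<alpha> "comp Rg (r j) \<alpha>"] comp_in r jk B(2) by blast
    ultimately have "(comp Rg (r j) \<alpha> / (h * t ^ j)) * (comp Rg (r k) \<alpha> / comp Rg (r j) \<alpha>) /
        (comp Rg (r k) \<alpha> / (h * t ^ k)) \<in> B"
      by (intro mult_subgroup_divide[OF B(1) mult_subgroup_mult[OF B(1)]])
    moreover have "(comp Rg (r j) \<alpha> / (h * t ^ j)) * (comp Rg (r k) \<alpha> / comp Rg (r j) \<alpha>) /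
        (comp Rg (r k) \<alpha> / (h * t ^ k)) = t ^ k / t ^ j"
      using jk h0 nz by simp
    moreover have "t ^ k / t ^ j = t powi (int k - int j)"
      using nz by (simp add: power_int_diff)
    ultimately show False using t(2)[of "int k - int j"] ne by simp
  qed
  have "comp Rg (r j) \<alpha> = 0" if j: "j \<le> n" for j \<alpha>
  proof (rule ccontr)
    assume nz: "comp Rg (r j) \<alpha> \<noteq> 0"
    have "(\<Sum>j\<le>n. r j) = h * poly P t"
      by (simp add: r_def poly_altdef n_def sum_distrib_left)
    then have "0 = comp Rg (\<Sum>j\<le>n. r j) \<alpha>" using P by simp
    also have "\<dots> = (\<Sum>j\<le>n. comp Rg (r j) \<alpha>)" using r by (intro comp_sum) auto
    also have "\<dots> = (\<Sum>k\<in>{j}. comp Rg (r k) \<alpha>)"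
    proof (rule sum.mono_neutral_right)
      show "\<forall>k\<in>{..n} - {j}. comp Rg (r k) \<alpha> = 0" using disj[OF _ j _ nz] by blast
    qed (use j in auto)
    finally show False using nz by simp
  qed
  then have "r j = 0" if "j \<le> n" for j using eq_0_if_comp r that by blast
  then have "coeff P n = 0" using h0 nz by (simp add: r_def)
  then show ?thesis by (simp add: n_def)
qed

section \<open>The degree-zero field and iterated Laurent rings over it\<close>

lemma is_subring_field0: "is_subring (insert 0 units0)"
  and field0_inverse: "x \<in> insert 0 units0 \<Longrightarrow> inverse x \<in> insert 0 units0"
proof -
  note G = mult_subgroup_units0
  have m: "- 1 \<in> units0"
    using units0I[OF Rg_diff[OF Rg_0 one_homogeneous] one_homogeneous] by simp
  have add: "x + y \<in> insert 0 units0" if x: "x \<in> units0" and y: "y \<in> units0" for x y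
  proof -
    obtain a b \<alpha> where a: "a \<in> Rg \<alpha>" "b \<in> Rg \<alpha>" "a \<noteq> 0" "b \<noteq> 0" "x = a / b" using x unfolding units0_def by blast
    obtain c d \<beta> where c: "c \<in> Rg \<beta>" "d \<in> Rg \<beta>" "c \<noteq> 0" "d \<noteq> 0" "y = c / d" using y unfolding units0_def by blast
    have "x + y = (a * d + c * b) / (b * d)" using a c by (simp add: add_frac_eq)
    moreover have "a * d + c * b \<in> Rg (\<alpha> + \<beta>)" "b * d \<in> Rg (\<alpha> + \<beta>)"
      using a c Rg_mult[of c \<beta> b \<alpha>] by (auto intro!: Rg_add Rg_mult simp: add.commute)
    ultimately show ?thesis using units0I[of "a * d + c * b" "\<alpha> + \<beta>" "b * d"] a c by auto
  qed
  have add': "x + y \<in> insert 0 units0" if "x \<in> insert 0 units0" "y \<in> insert 0 units0" for x y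
    using that add by auto
  have mult': "x * y \<in> insert 0 units0" if "x \<in> insert 0 units0" "y \<in> insert 0 units0" for x y
    using that mult_subgroup_mult[OF G] by auto
  have diff': "x - y \<in> insert 0 units0" if "x \<in> insert 0 units0" "y \<in> insert 0 units0" for x y
    using add'[OF that(1) mult'[of "- 1" y]] m that(2) by simp
  show "is_subring (insert 0 units0)"
    unfolding is_subring_def
    by (intro conjI ballI add' mult' diff' insertI1 insertI2[OF mult_subgroup_1[OF G]])
  show "x \<in> insert 0 units0 \<Longrightarrow> inverse x \<in> insert 0 units0"
    using mult_subgroup_inverse[OF G] by auto
qed

fun laurents :: "'k list \<Rightarrow> 'k set" where
  "laurents [] = insert 0 units0"
| "laurents (t # ts) = laurent (laurents ts) t"

lemma is_subring_laurents: "0 \<notin> set ts \<Longrightarrow> is_subring (laurents ts)"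
  by (induction ts) (auto simp: is_subring_field0 is_subring_laurent)

lemma mspan_laurents: "0 \<notin> set ts \<Longrightarrow> mspan units0 ts \<subseteq> laurents ts"
proof (induction ts)
  case (Cons t ts)
  then have A: "is_subring (laurents ts)" "is_subring (laurents (t # ts))"
    using is_subring_laurents[of ts] is_subring_laurents[of "t # ts"] by simp_all
  show ?case
  proof
    fix x assume "x \<in> mspan units0 (t # ts)"
    then obtain k u where x: "u \<in> mspan units0 ts" "x = t powi k * u" by auto
    then have "u \<in> laurents (t # ts)" "t powi k \<in> laurents (t # ts)"
      using Cons laurent_incl[OF A(1)] power_int_in_laurent[OF A(1)] by auto
    then show "x \<in> laurents (t # ts)" unfolding x(2) by (intro subring_mult A)
  qed
qed auto

lemma mspan_units:
  assumes "set ts \<subseteq> unitsH"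
  shows "mult_subgroup (mspan units0 ts)" "units0 \<subseteq> mspan units0 ts" "mspan units0 ts \<subseteq> unitsH"
proof -
  show "mult_subgroup (mspan units0 ts)"
    using assms mult_subgroup_nz[OF mult_subgroup_unitsH, of 0]
    by (intro mult_subgroup_mspan mult_subgroup_units0) auto
  show "units0 \<subseteq> mspan units0 ts"
    by (induction ts) (use mspan_tail in \<open>auto simp del: mspan.simps(2), blast\<close>)
  show "mspan units0 ts \<subseteq> unitsH"
    using assms units0_incl
    by (induction ts) (auto intro!: mult_subgroup_mult[OF mult_subgroup_unitsH]
        mult_subgroup_power_int[OF mult_subgroup_unitsH])
qed

text \<open>Used twice: it makes the next basis element transcendental over the ring built so far,
  and it finally places that ring inside R_H.\<close>

lemma laurents_part: "set ts \<subseteq> unitsH \<Longrightarrow> laurents ts \<subseteq> part (mspan units0 ts)"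
proof (induction ts)
  case Nil
  then show ?case
    using unit_in_part[of _ units0] units0_incl
      subring_0[OF is_subring_part[OF mult_subgroup_units0 order_refl]] by auto
next
  case (Cons t ts)
  note B = mspan_units[OF Cons.prems]
  have sub: "is_subring (part (mspan units0 (t # ts)))"
    using B by (intro is_subring_part)
  have pw: "t powi k \<in> part (mspan units0 (t # ts))" for k
    using mspan_head[of units0 ts t k] mspan_units(1)[of ts] Cons.prems B(3)
    by (intro unit_in_part) (auto simp del: mspan.simps)
  show ?case
  proof
    fix x assume "x \<in> laurents (t # ts)"
    then obtain p m where p: "p \<in> polys_over (laurents ts)" "x = poly p t / t ^ m"
      by (auto simp: laurent_def)
    have "laurents ts \<subseteq> part (mspan units0 ts)" using Cons by simp
    also have "\<dots> \<subseteq> part (mspan units0 (t # ts))" by (rule part_mono[OF mspan_tail])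
    finally have "p \<in> polys_over (part (mspan units0 (t # ts)))"
      using p(1) polys_over_mono by blast
    moreover have "t \<in> part (mspan units0 (t # ts))" using pw[of 1] by (simp del: mspan.simps)
    ultimately have "poly p t \<in> part (mspan units0 (t # ts))" by (rule poly_in_subring[OF sub])
    moreover have "x = poly p t * t powi (- int m)"
      by (simp add: p power_int_minus divide_inverse)
    ultimately show "x \<in> part (mspan units0 (t # ts))"
      using subring_mult[OF sub] pw by metis
  qed
qed

lemma completely_integrally_closed_laurents:
  "mindep units0 ts \<Longrightarrow> set ts \<subseteq> unitsH \<Longrightarrow> completely_integrally_closed (laurents ts)"
proof (induction ts)
  case Nil
  have "y \<in> insert 0 units0" if "d \<in> insert 0 units0" "d \<noteq> 0" "\<And>k. d * y ^ k \<in> insert 0 units0" for d y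
  proof -
    have "inverse d * (d * y ^ 1) \<in> insert 0 units0"
      by (rule subring_mult[OF is_subring_field0 field0_inverse[OF that(1)] that(3)])
    moreover have "inverse d * (d * y ^ 1) = y" using that(2) by simp
    ultimately show ?thesis by (simp only:)
  qed
  then show ?case unfolding completely_integrally_closed_def laurents.simps by blast
next
  case (Cons t ts)
  have nz: "0 \<notin> set ts" "t \<noteq> 0" using Cons.prems mult_subgroup_nz[OF mult_subgroup_unitsH] by auto
  have ts: "set ts \<subseteq> unitsH" using Cons.prems by simp
  note B = mspan_units[OF ts]
  show ?case unfolding laurents.simps
  proof (rule completely_integrally_closed_laurent)
    fix p assume "p \<in> polys_over (laurents ts)" "poly p t = 0"
    then show "p = 0"
      using transcendental_over_part[OF B, of t p] Cons.prems
        polys_over_mono[OF laurents_part[OF ts]] by auto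
  qed (use nz is_subring_laurents Cons in auto)
qed

lemma integral_imp_RH:
  assumes p: "p \<in> polys_over R" "lead_coeff p = 1" "poly p x = 0"
  shows "x \<in> RH R Rg"
proof -
  obtain a b where ab: "a \<in> R" "b \<in> R" "b \<noteq> 0" "x = a / b" using K_fraction by blast
  \<comment> \<open>Numerator and denominator are included besides the coefficients, so that
    \<open>b ^ degree p\<close> is a denominator, within the Laurent ring, for all powers of
    \<open>x\<close>.\<close>
  define X where "X = insert a (insert b (coeff p ` {..degree p}))"
  have X: "finite X" "X \<subseteq> R" using ab p by (auto simp: X_def coeff_in)
  define S where "S = (\<Union>r\<in>X. comp Rg r ` {\<alpha>. comp Rg r \<alpha> \<noteq> 0})"
  have "finite S" unfolding S_def using X finite_comp by auto
  moreover have "S \<subseteq> unitsH"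
  proof
    fix s assume "s \<in> S"
    then obtain r \<alpha> where "r \<in> R" "s = comp Rg r \<alpha>" "s \<noteq> 0" using X unfolding S_def by auto
    then have "s \<in> homog Rg" using comp_in homogI by metis
    then show "s \<in> unitsH" using unitsHI[OF _ homog_1] by force
  qed
  ultimately have "\<exists>ts. mindep units0 ts \<and> set ts \<subseteq> unitsH \<and> S \<subseteq> mspan units0 ts"
    by (intro exists_mindep_mspan mult_subgroup_units0 mult_subgroup_unitsH units0_incl)
      (rule unitsH_torsion_free)
  then obtain ts where ts: "mindep units0 ts" "set ts \<subseteq> unitsH" "S \<subseteq> mspan units0 ts"
    by blast
  have nz: "0 \<notin> set ts" using ts(2) mult_subgroup_nz[OF mult_subgroup_unitsH] by auto
  note A = is_subring_laurents[OF nz]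
  have X_A: "r \<in> laurents ts" if r: "r \<in> X" for r
  proof -
    have "(\<Sum>\<alpha> | comp Rg r \<alpha> \<noteq> 0. comp Rg r \<alpha>) \<in> laurents ts"
      using r ts(3) mspan_laurents[OF nz] by (intro subring_sum[OF A]) (auto simp: S_def)
    then show ?thesis using sum_comp r X by auto
  qed
  have "coeff p i \<in> laurents ts" for i
    using X_A[of "coeff p i"] subring_0[OF A]
    by (cases "i \<le> degree p") (auto simp: X_def coeff_eq_0)
  then have "p \<in> polys_over (laurents ts)" by (simp add: polys_over_def)
  then have "b ^ degree p * x ^ k \<in> laurents ts" for k
    using integral_imp_almost_integral[OF A] X_A ab p by (auto simp: X_def)
  moreover have "b ^ degree p \<in> laurents ts" using X_A by (auto simp: X_def intro!: subring_power[OF A])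
  ultimately have "x \<in> laurents ts"
    using completely_integrally_closedD[OF completely_integrally_closed_laurents[OF ts(1,2)],
        of "b ^ degree p" x] ab(3) by simp
  then show ?thesis using laurents_part[OF ts(2)] part_RH by blast
qed

end

section \<open>Contents\<close>

definition is_submodule :: "'k::field set \<Rightarrow> 'k set \<Rightarrow> bool" where
  "is_submodule R E \<longleftrightarrow> 0 \<in> E \<and> (\<forall>a\<in>E. \<forall>b\<in>E. a + b \<in> E) \<and> (\<forall>r\<in>R. \<forall>a\<in>E. r * a \<in> E)"

lemma
  assumes "is_submodule R E"
  shows submodule_0: "0 \<in> E" and submodule_add: "a \<in> E \<Longrightarrow> b \<in> E \<Longrightarrow> a + b \<in> E"
    and submodule_scale: "r \<in> R \<Longrightarrow> a \<in> E \<Longrightarrow> r * a \<in> E"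
  using assms unfolding is_submodule_def by auto

lemma submodule_sum: "is_submodule R E \<Longrightarrow> (\<And>i. i \<in> I \<Longrightarrow> f i \<in> E) \<Longrightarrow> sum f I \<in> E"
  by (induction I rule: infinite_finite_induct) (auto simp: submodule_0 submodule_add)

lemma submodule_uminus: "is_subring R \<Longrightarrow> is_submodule R E \<Longrightarrow> a \<in> E \<Longrightarrow> - a \<in> E"
  using submodule_scale[of R E "- 1" a] by (simp add: subring_uminus subring_1)

lemma nz_submod_iff: "nz_submod R E \<longleftrightarrow> is_submodule R E \<and> E \<noteq> {0}"
  unfolding nz_submod_def is_submodule_def by blast

lemma rmod_minimal:
  assumes "is_submodule R E" "S \<subseteq> E"
  shows "rmod R S \<subseteq> E"
proof
  fix x assume "x \<in> rmod R S"
  then obtain F c where "F \<subseteq> S" "\<forall>s\<in>F. c s \<in> R" "x = (\<Sum>s\<in>F. c s * s)" unfolding rmod_def by blast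
  then show "x \<in> E" using assms(2) by (auto intro!: submodule_sum[OF assms(1)] submodule_scale[OF assms(1)])
qed

lemma rmod_incl: "is_subring R \<Longrightarrow> S \<subseteq> rmod R S"
  unfolding rmod_def by (auto intro!: exI[of _ "{_}"] exI[of _ "\<lambda>_. 1"] simp: subring_1)

lemma is_submodule_rmod:
  assumes R: "is_subring R"
  shows "is_submodule R (rmod R S)"
  unfolding is_submodule_def
proof (intro conjI ballI)
  show "0 \<in> rmod R S" unfolding rmod_def by (auto intro!: exI[of _ "{}"])
  fix x assume "x \<in> rmod R S"
  then obtain F c where F: "finite F" "F \<subseteq> S" "\<forall>s\<in>F. c s \<in> R" "x = (\<Sum>s\<in>F. c s * s)"
    unfolding rmod_def by blast
  {
    fix y assume "y \<in> rmod R S"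
    then obtain G d where G: "finite G" "G \<subseteq> S" "\<forall>s\<in>G. d s \<in> R" "y = (\<Sum>s\<in>G. d s * s)"
      unfolding rmod_def by blast
    define e where "e s = (if s \<in> F then c s else 0) + (if s \<in> G then d s else 0)" for s
    have "(\<Sum>s\<in>F \<union> G. e s * s) =
        (\<Sum>s\<in>F \<union> G. if s \<in> F then c s * s else 0) + (\<Sum>s\<in>F \<union> G. if s \<in> G then d s * s else 0)"
      unfolding e_def sum.distrib[symmetric] by (intro sum.cong) (auto simp: algebra_simps)
    also have "\<dots> = x + y"
      using F G by (simp add: sum.If_cases Int_absorb1 Int_absorb2 flip: sum.inter_restrict)
    finally have "x + y = (\<Sum>s\<in>F \<union> G. e s * s)" by simp
    moreover have "\<forall>s\<in>F \<union> G. e s \<in> R" using F G R by (auto simp: e_def subring_add)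
    ultimately show "x + y \<in> rmod R S"
      unfolding rmod_def using F(1,2) G(1,2) by (intro CollectI exI[of _ "F \<union> G"] exI[of _ e] conjI) auto
  }
  fix r assume "r \<in> R"
  then have "\<forall>s\<in>F. r * c s \<in> R" "r * x = (\<Sum>s\<in>F. (r * c s) * s)"
    using F R by (auto simp: subring_mult sum_distrib_left mult.assoc)
  then show "r * x \<in> rmod R S"
    unfolding rmod_def using F(1,2) by (intro CollectI exI[of _ F] exI[of _ "\<lambda>s. r * c s"] conjI)
qed

lemma is_submodule_colon: "is_subring R \<Longrightarrow> is_submodule R (colon R E)"
  unfolding is_submodule_def colon_def
  by (auto simp: subring_0 subring_add subring_mult distrib_right mult.assoc)

lemma is_submodule_times_in: "is_subring R \<Longrightarrow> is_submodule R {a. x * a \<in> R}"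
  unfolding is_submodule_def
  by (auto simp: subring_0 subring_add subring_mult distrib_left mult.left_commute)

lemma colon_rmod:
  assumes R: "is_subring R"
  shows "colon R (rmod R S) = colon R S"
proof -
  have "x \<in> colon R (rmod R S)" if "x \<in> colon R S" for x
    using rmod_minimal[OF is_submodule_times_in[OF R, of x], of S] that by (auto simp: colon_def)
  then show ?thesis using rmod_incl[OF R, of S] unfolding colon_def by auto
qed

lemma colon_mprod: "is_subring R \<Longrightarrow> x \<in> colon R (mprod R E F) \<longleftrightarrow> (\<forall>a\<in>E. \<forall>b\<in>F. x * (a * b) \<in> R)"
  unfolding mprod_def by (auto simp: colon_rmod) (auto simp: colon_def)

lemma colon_mprod_rmod:
  assumes R: "is_subring R"
  shows "x \<in> colon R (mprod R (rmod R S) (rmod R T)) \<longleftrightarrow> (\<forall>a\<in>S. \<forall>b\<in>T. x * (a * b) \<in> R)"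
proof
  assume "x \<in> colon R (mprod R (rmod R S) (rmod R T))"
  then show "\<forall>a\<in>S. \<forall>b\<in>T. x * (a * b) \<in> R"
    using rmod_incl[OF R] by (auto simp: colon_mprod[OF R])
next
  assume *: "\<forall>a\<in>S. \<forall>b\<in>T. x * (a * b) \<in> R"
  have 1: "x * a * b \<in> R" if "a \<in> S" "b \<in> rmod R T" for a b
    using rmod_minimal[OF is_submodule_times_in[OF R, of "x * a"], of T] * that by (auto simp: mult.assoc)
  have "x * b * a \<in> R" if "a \<in> rmod R S" "b \<in> rmod R T" for a b
    using rmod_minimal[OF is_submodule_times_in[OF R, of "x * b"], of S] 1 that by (auto simp: mult_ac)
  then show "x \<in> colon R (mprod R (rmod R S) (rmod R T))"
    by (auto simp: colon_mprod[OF R] mult_ac)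
qed

lemma colon_antimono: "E \<subseteq> F \<Longrightarrow> colon R F \<subseteq> colon R E"
  unfolding colon_def by blast

lemma subset_colon_colon: "E \<subseteq> colon R (colon R E)"
  unfolding colon_def by (auto simp: mult.commute)

text \<open>The map from E to (R : E) is a Galois connection with itself. Hence two modules have the
  same v-closure exactly when their colon modules agree.\<close>

lemma colon_colon_colon: "colon R (colon R (colon R E)) = colon R E"
  using subset_colon_colon[of "colon R E" R] colon_antimono[OF subset_colon_colon[of E R], of R] by blast

lemma colon_scale:
  assumes "x \<noteq> 0"
  shows "colon R ((*) x ` E) = (*) (inverse x) ` colon R E"
proof -
  have "y \<in> (*) (inverse x) ` colon R E" if "y \<in> colon R ((*) x ` E)" for y
    using that assms by (intro image_eqI[of _ _ "x * y"]) (auto simp: colon_def mult_ac)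
  moreover have "inverse x * y \<in> colon R ((*) x ` E)" if y: "y \<in> colon R E" for y
  proof -
    have "(inverse x * y) * (x * e) \<in> R" if e: "e \<in> E" for e
    proof -
      have "y * e \<in> R" using y e by (simp add: colon_def)
      also have "y * e = (inverse x * y) * (x * e)" using assms by simp
      finally show ?thesis .
    qed
    then show ?thesis by (simp add: colon_def)
  qed
  ultimately show ?thesis by blast
qed

lemma colon_self: "is_subring R \<Longrightarrow> colon R R = R"
  unfolding colon_def by (auto simp: subring_mult) (metis mult.right_neutral subring_1)

text \<open>Supplies the witness for (3). When \<open>colon R E\<close> is zero the closure is the
  whole field, so the operation makes sense for all nonzero submodules and not only for fractional
  ideals.\<close>

lemma semi_star_vclos:
  assumes R: "is_subring R"
  shows "semi_star R (vclos R)"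
  unfolding semi_star_def semistar_def
proof (intro conjI allI impI)
  fix E F assume E: "nz_submod R E"
  have EE: "E \<subseteq> vclos R E" unfolding vclos_def by (rule subset_colon_colon)
  then show "E \<subseteq> vclos R E" .
  show "nz_submod R (vclos R E)"
    using is_submodule_colon[OF R, of "colon R E"] EE E by (auto simp: nz_submod_iff vclos_def submodule_0)
  show "vclos R ((*) x ` E) = (*) x ` vclos R E" if "x \<noteq> 0" for x
    using that unfolding vclos_def by (simp add: colon_scale)
  show "vclos R E \<subseteq> vclos R F" if "E \<subseteq> F"
    using that unfolding vclos_def by (intro colon_antimono)
  show "vclos R (vclos R E) = vclos R E"
    unfolding vclos_def by (simp add: colon_colon_colon)
qed (use R in \<open>simp add: vclos_def colon_self\<close>)

text \<open>Turns condition (4) into a statement about single coefficients.\<close>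

lemma ext_mod_eq_polys_over:
  assumes R: "is_subring R" and I: "is_submodule R I"
  shows "ext_mod R I = polys_over I"
proof
  show "ext_mod R I \<subseteq> polys_over I"
  proof
    fix p assume "p \<in> ext_mod R I"
    then obtain n c g where p: "\<forall>i<(n::nat). c i \<in> I \<and> g i \<in> polys_over R" "p = (\<Sum>i<n. smult (c i) (g i))"
      unfolding ext_mod_def by blast
    have "coeff p k \<in> I" for k
      unfolding p(2) coeff_sum coeff_smult
      by (intro submodule_sum[OF I]) (use p(1) in \<open>auto simp: mult.commute[of "c _"] coeff_in intro!: submodule_scale[OF I]\<close>)
    then show "p \<in> polys_over I" by (simp add: polys_over_def)
  qed
  show "polys_over I \<subseteq> ext_mod R I"
  proof
    fix p assume p: "p \<in> polys_over I"
    have "p = (\<Sum>i<Suc (degree p). smult (coeff p i) (monom 1 i))"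
      by (simp add: smult_monom poly_as_sum_of_monoms lessThan_Suc_atMost del: sum.lessThan_Suc)
    then show "p \<in> ext_mod R I" unfolding ext_mod_def
      using p R by (auto simp: coeff_in monom_in_polys_over subring_1 intro!: exI[of _ "Suc (degree p)"]
        exI[of _ "coeff p"] exI[of _ "\<lambda>i. monom 1 i"])
  qed
qed

lemma coeff_mult_double_sum:
  fixes f g :: "'a::comm_ring_1 poly"
  shows "coeff (f * g) k = (\<Sum>i\<le>degree f. \<Sum>j\<le>degree g. if i + j = k then coeff f i * coeff g j else 0)"
proof -
  have "f * g = (\<Sum>i\<le>degree f. monom (coeff f i) i) * (\<Sum>j\<le>degree g. monom (coeff g j) j)"
    by (simp add: poly_as_sum_of_monoms)
  also have "\<dots> = (\<Sum>i\<le>degree f. \<Sum>j\<le>degree g. monom (coeff f i * coeff g j) (i + j))"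
    by (simp add: sum_product mult_monom)
  finally have "coeff (f * g) k = coeff (\<Sum>i\<le>degree f. \<Sum>j\<le>degree g. monom (coeff f i * coeff g j) (i + j)) k"
    by simp
  then show ?thesis by (simp add: coeff_sum coeff_monom)
qed

lemma torsion_free_quotient_prod_nat:
  assumes "torsion_free_quotient TYPE('g::cancel_comm_monoid_add)"
  shows "torsion_free_quotient TYPE('g \<times> nat)"
  unfolding torsion_free_quotient_def
proof (intro allI impI)
  fix n :: nat and a b :: "'g \<times> nat"
  assume n: "n > 0" and "(\<Sum>i<n. a) = (\<Sum>i<n. b)"
  then have "fst (\<Sum>i<n. a) = fst (\<Sum>i<n. b)" "snd (\<Sum>i<n. a) = snd (\<Sum>i<n. b)" by simp_all
  then have "(\<Sum>i<n. fst a) = (\<Sum>i<n. fst b)" "(\<Sum>i<n. snd a) = (\<Sum>i<n. snd b)"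
    by (simp_all only: fst_sum snd_sum)
  then show "a = b"
    using n assms unfolding torsion_free_quotient_def by (auto simp: prod_eq_iff)
qed

text \<open>Synthetic division: each coefficient of \<open>g\<close> is obtained from the next
  higher one, starting from the zeros above the degree.\<close>

lemma linear_factor_cofactor:
  assumes S: "is_subring S" and x: "x \<in> S" and p: "[:- x, 1:] * g \<in> polys_over S"
  shows "g \<in> polys_over S"
proof -
  have step: "coeff g i = coeff ([:- x, 1:] * g) (Suc i) + x * coeff g (Suc i)" for i by simp
  have "coeff g i \<in> S" for i
  proof (induction "Suc (degree g) - i" arbitrary: i rule: less_induct)
    case less
    show ?case
    proof (cases "i > degree g")
      case True
      then show ?thesis using S by (simp add: coeff_eq_0 subring_0)
    next
      case False
      then have "coeff g (Suc i) \<in> S" by (intro less) auto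
      then show ?thesis by (subst step) (intro subring_add[OF S] subring_mult[OF S] x coeff_in[OF p])
    qed
  qed
  then show ?thesis by (simp add: polys_over_def)
qed

section \<open>Contents of products and the implications between the conditions\<close>

context torsionless_graded_domain
begin

lemma is_subring_RH: "is_subring (RH R Rg)"
proof -
  have "x \<in> part unitsH" if x: "x \<in> RH R Rg" for x
  proof -
    obtain r h where r: "r \<in> R" "h \<in> homog Rg" "x = r / h" using RHE x by blast
    have "comp Rg r \<alpha> / h \<in> insert 0 unitsH" for \<alpha>
      using unitsHI[OF homogI[OF comp_in[OF r(1)]] r(2), of \<alpha>] by (cases "comp Rg r \<alpha> = 0") auto
    then show ?thesis using part_iff r by blast
  qed
  then have "RH R Rg = part unitsH" using part_RH by blast
  then show ?thesis using is_subring_part[OF mult_subgroup_unitsH units0_incl] by simp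
qed

definition degrees :: "'k poly \<Rightarrow> 'g set" where
  "degrees f = (\<Union>i\<le>degree f. {\<alpha>. comp Rg (coeff f i) \<alpha> \<noteq> 0})"

lemma finite_degrees: "f \<in> polys_over R \<Longrightarrow> finite (degrees f)"
  unfolding degrees_def by (intro finite_UN_I finite_comp) (auto simp: coeff_in)

lemma comp_coeff_support:
  assumes "comp Rg (coeff f i) \<alpha> \<noteq> 0"
  shows "\<alpha> \<in> degrees f" "i \<le> degree f"
proof -
  show "i \<le> degree f" using assms by (metis coeff_eq_0 comp_0 not_le_imp_less)
  then show "\<alpha> \<in> degrees f" using assms unfolding degrees_def by auto
qed

text \<open>With the exponent of X as a second coordinate of the degree, multiplication is a plain
  convolution, the shape required by \<open>coefficient_products_in_integrally_closed\<close>. The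
  exchanges of sums bring each degree next to its exponent.\<close>

lemma comp_coeff_mult:
  assumes f: "f \<in> polys_over R" and g: "g \<in> polys_over R"
  shows "comp Rg (coeff (f * g) k) \<gamma> =
    (\<Sum>(m, n)\<in>{(m, n). m \<in> degrees f \<times> {..degree f} \<and> n \<in> degrees g \<times> {..degree g} \<and> m + n = (\<gamma>, k)}.
      comp Rg (coeff f (snd m)) (fst m) * comp Rg (coeff g (snd n)) (fst n))"
proof -
  define S where "S = degrees f"
  define T where "T = degrees g"
  define I where "I = {..degree f}"
  define J where "J = {..degree g}"
  have fin: "finite S" "finite T" "finite I" "finite J"
    using finite_degrees f g by (auto simp: S_def T_def I_def J_def)
  define w where "w i j \<alpha> \<beta> = (if i + j = k \<and> \<alpha> + \<beta> = \<gamma> then comp Rg (coeff f i) \<alpha> * comp Rg (coeff g j) \<beta> else 0)"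
    for i j \<alpha> \<beta>
  have fi: "coeff f i \<in> R" "coeff g i \<in> R" for i using f g by (auto simp: coeff_in)
  have ij: "coeff f i * coeff g j \<in> R" for i j using fi R_subring by (simp add: subring_mult)
  have cp: "(\<Sum>a\<in>A. \<Sum>b\<in>B. H a b) = (\<Sum>m\<in>A \<times> B. H (fst m) (snd m))"
    for A :: "'g set" and B :: "nat set" and H :: "'g \<Rightarrow> nat \<Rightarrow> 'k"
    by (simp add: sum.cartesian_product case_prod_beta)
  have w_eq: "comp Rg (if i + j = k then coeff f i * coeff g j else 0) \<gamma> = (\<Sum>\<alpha>\<in>S. \<Sum>\<beta>\<in>T. w i j \<alpha> \<beta>)" for i j
  proof (cases "i + j = k")
    case True
    have "comp Rg (coeff f i * coeff g j) \<gamma> = (\<Sum>(\<alpha>, \<beta>)\<in>S \<times> T. if \<alpha> + \<beta> = \<gamma> then comp Rg (coeff f i) \<alpha> * comp Rg (coeff g j) \<beta> else 0)"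
      using fin comp_coeff_support(1) by (intro comp_mult fi) (auto simp: S_def T_def)
    then show ?thesis using True by (simp add: w_def sum.cartesian_product)
  qed (simp add: w_def)
  have "comp Rg (coeff (f * g) k) \<gamma> = (\<Sum>i\<in>I. comp Rg (\<Sum>j\<in>J. if i + j = k then coeff f i * coeff g j else 0) \<gamma>)"
    unfolding coeff_mult_double_sum I_def J_def
    by (rule comp_sum) (use ij R_subring in \<open>auto intro!: subring_sum subring_0\<close>)
  also have "\<dots> = (\<Sum>i\<in>I. \<Sum>j\<in>J. comp Rg (if i + j = k then coeff f i * coeff g j else 0) \<gamma>)"
    by (intro sum.cong refl comp_sum) (use ij R_subring in \<open>auto intro: subring_0\<close>)
  also have "\<dots> = (\<Sum>i\<in>I. \<Sum>j\<in>J. \<Sum>\<alpha>\<in>S. \<Sum>\<beta>\<in>T. w i j \<alpha> \<beta>)" by (simp only: w_eq)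
  also have "\<dots> = (\<Sum>i\<in>I. \<Sum>\<alpha>\<in>S. \<Sum>j\<in>J. \<Sum>\<beta>\<in>T. w i j \<alpha> \<beta>)"
    by (intro sum.cong refl sum.swap)
  also have "\<dots> = (\<Sum>\<alpha>\<in>S. \<Sum>i\<in>I. \<Sum>j\<in>J. \<Sum>\<beta>\<in>T. w i j \<alpha> \<beta>)" by (rule sum.swap)
  also have "\<dots> = (\<Sum>\<alpha>\<in>S. \<Sum>i\<in>I. \<Sum>\<beta>\<in>T. \<Sum>j\<in>J. w i j \<alpha> \<beta>)"
    by (intro sum.cong refl sum.swap)
  also have "\<dots> = (\<Sum>m\<in>S \<times> I. \<Sum>n\<in>T \<times> J. w (snd m) (snd n) (fst m) (fst n))"
    by (simp only: cp)
  also have "\<dots> = (\<Sum>(m, n)\<in>(S \<times> I) \<times> (T \<times> J). w (snd m) (snd n) (fst m) (fst n))"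
    by (rule sum.cartesian_product)
  also have "\<dots> = (\<Sum>(m, n)\<in>{(m, n). m \<in> S \<times> I \<and> n \<in> T \<times> J \<and> m + n = (\<gamma>, k)}.
      comp Rg (coeff f (snd m)) (fst m) * comp Rg (coeff g (snd n)) (fst n))"
    using fin by (intro sum.mono_neutral_cong_right) (auto simp: w_def split: if_splits)
  finally show ?thesis by (simp only: S_def T_def I_def J_def)
qed

lemma gauss_prufer:
  assumes ic: "integrally_closed R" and f: "f \<in> polys_over R" and g: "g \<in> polys_over R"
    and x: "\<And>k \<gamma>. x * comp Rg (coeff (f * g) k) \<gamma> \<in> R"
  shows "x * (comp Rg (coeff f i) \<alpha> * comp Rg (coeff g j) \<beta>) \<in> R"
proof (cases "comp Rg (coeff f i) \<alpha> = 0 \<or> comp Rg (coeff g j) \<beta> = 0")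
  case True
  then show ?thesis using R_subring by (auto simp: subring_0)
next
  case False
  have "x * ((\<lambda>m. comp Rg (coeff f (snd m)) (fst m)) (\<alpha>, i) * (\<lambda>n. comp Rg (coeff g (snd n)) (fst n)) (\<beta>, j)) \<in> R"
  proof (rule coefficient_products_in_integrally_closed[OF torsion_free_quotient_prod_nat[OF torsion_free] R_subring ic])
    show "finite (degrees f \<times> {..degree f})" "finite (degrees g \<times> {..degree g})"
      using finite_degrees f g by auto
    show "(\<alpha>, i) \<in> degrees f \<times> {..degree f}" "(\<beta>, j) \<in> degrees g \<times> {..degree g}"
      using False comp_coeff_support by auto
    show "x * (\<Sum>(m, n)\<in>{(m, n). m \<in> degrees f \<times> {..degree f} \<and> n \<in> degrees g \<times> {..degree g} \<and> m + n = p}.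
        comp Rg (coeff f (snd m)) (fst m) * comp Rg (coeff g (snd n)) (fst n)) \<in> R" for p
      using x[of "snd p" "fst p"] unfolding comp_coeff_mult[OF f g] by simp
  qed
  then show ?thesis by simp
qed

lemma Ball_compsH:
  assumes "r \<in> R" "h \<in> homog Rg" "P 0"
  shows "(\<forall>a\<in>compsH R Rg (r / h). P a) \<longleftrightarrow> (\<forall>\<alpha>. P (comp Rg r \<alpha> / h))"
  using compsH_memI[OF assms(1,2)] compsH_memE[OF _ assms(1,2)] assms(3) by metis

text \<open>A single common denominator represents all coefficients at once; the unbounded range of
  \<open>i\<close> and \<alpha> contributes only additional zeros, which \<open>P 0\<close>
  absorbs.\<close>

lemma Ball_Af_gens:
  assumes f: "smult h f \<in> polys_over R" "h \<in> homog Rg" and P: "P 0"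
  shows "(\<forall>a\<in>(\<Union>i\<le>degree f. compsH R Rg (coeff f i)). P a) \<longleftrightarrow>
    (\<forall>i \<alpha>. P (comp Rg (coeff (smult h f) i) \<alpha> / h))"
proof -
  have h: "h \<noteq> 0" using f homog_nz by blast
  have *: "(\<forall>a\<in>compsH R Rg (coeff f i). P a) \<longleftrightarrow> (\<forall>\<alpha>. P (comp Rg (coeff (smult h f) i) \<alpha> / h))" for i
    using Ball_compsH[of "coeff (smult h f) i" h P] coeff_in[OF f(1), of i] f(2) P h by simp
  have "P (comp Rg (coeff (smult h f) i) \<alpha> / h)" if "i > degree f" for i \<alpha>
    using that P by (simp add: coeff_eq_0)
  then show ?thesis using * by (metis (no_types, lifting) UN_iff atMost_iff not_le_imp_less)
qed

lemma colon_Af_iff: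
  assumes f: "smult h f \<in> polys_over R" "h \<in> homog Rg"
  shows "x \<in> colon R (Af R Rg f) \<longleftrightarrow> (\<forall>i \<alpha>. x * (comp Rg (coeff (smult h f) i) \<alpha> / h) \<in> R)"
  unfolding Af_def colon_rmod[OF R_subring]
  using Ball_Af_gens[OF f, of "\<lambda>a. x * a \<in> R"] subring_0[OF R_subring] by (simp add: colon_def)

lemma colon_mprod_Af_iff:
  assumes f: "smult h f \<in> polys_over R" "h \<in> homog Rg" and g: "smult k g \<in> polys_over R" "k \<in> homog Rg"
  shows "x \<in> colon R (mprod R (Af R Rg f) (Af R Rg g)) \<longleftrightarrow>
    (\<forall>i \<alpha> j \<beta>. x * ((comp Rg (coeff (smult h f) i) \<alpha> / h) * (comp Rg (coeff (smult k g) j) \<beta> / k)) \<in> R)"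
proof -
  have g_iff: "(\<forall>b\<in>(\<Union>i\<le>degree g. compsH R Rg (coeff g i)). x * (a * b) \<in> R) \<longleftrightarrow>
      (\<forall>j \<beta>. x * (a * (comp Rg (coeff (smult k g) j) \<beta> / k)) \<in> R)" for a
    by (rule Ball_Af_gens[OF g]) (simp add: subring_0[OF R_subring])
  show ?thesis
    unfolding Af_def colon_mprod_rmod[OF R_subring] g_iff
    by (rule Ball_Af_gens[OF f]) (simp add: subring_0[OF R_subring])
qed

text \<open>Components of \<open>f * g\<close> are sums of products of components, which gives one
  inclusion for every \<open>R\<close>; the other is the Gauss-Prufer property.\<close>

lemma colon_Af_mult:
  assumes ic: "integrally_closed R" and f: "f \<in> polys_over R" and g: "g \<in> polys_over R"
  shows "colon R (mprod R (Af R Rg f) (Af R Rg g)) = colon R (Af R Rg (f * g))"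
proof -
  have fg: "f * g \<in> polys_over R" using f g subring_mult[OF is_subring_polys_over[OF R_subring]] by blast
  have U: "x \<in> colon R (mprod R (Af R Rg f) (Af R Rg g)) \<longleftrightarrow>
      (\<forall>i \<alpha> j \<beta>. x * (comp Rg (coeff f i) \<alpha> * comp Rg (coeff g j) \<beta>) \<in> R)" for x
    using colon_mprod_Af_iff[of 1 f 1 g] f g homog_1 by simp
  have W: "x \<in> colon R (Af R Rg (f * g)) \<longleftrightarrow> (\<forall>k \<gamma>. x * comp Rg (coeff (f * g) k) \<gamma> \<in> R)" for x
    using colon_Af_iff[of 1 "f * g"] fg homog_1 by simp
  show ?thesis
  proof (intro set_eqI iffI)
    fix x assume "x \<in> colon R (mprod R (Af R Rg f) (Af R Rg g))"
    then have "x * comp Rg (coeff (f * g) k) \<gamma> \<in> R" for k \<gamma>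
      unfolding comp_coeff_mult[OF f g] sum_distrib_left U
      by (intro subring_sum[OF R_subring]) auto
    then show "x \<in> colon R (Af R Rg (f * g))" using W by blast
  next
    fix x assume "x \<in> colon R (Af R Rg (f * g))"
    then show "x \<in> colon R (mprod R (Af R Rg f) (Af R Rg g))"
      using W U gauss_prufer[OF ic f g] by blast
  qed
qed

text \<open>Multiplying a polynomial by a homogeneous element multiplies its content by that
  element, so denominators can be cleared. The equality over \<open>R\<close> is taken as an
  assumption because it comes once from (1) and once from (2).\<close>

lemma colon_Af_mult_RH:
  assumes hyp: "\<And>f g. f \<in> polys_over R \<Longrightarrow> g \<in> polys_over R \<Longrightarrow> f \<noteq> 0 \<Longrightarrow> g \<noteq> 0 \<Longrightarrow>
      colon R (mprod R (Af R Rg f) (Af R Rg g)) = colon R (Af R Rg (f * g))"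
    and f: "f \<in> polys_over (RH R Rg)" "f \<noteq> 0" and g: "g \<in> polys_over (RH R Rg)" "g \<noteq> 0"
  shows "colon R (mprod R (Af R Rg f) (Af R Rg g)) = colon R (Af R Rg (f * g))"
proof (intro set_eqI)
  fix x
  obtain h where h: "h \<in> homog Rg" "smult h f \<in> polys_over R" using common_denominator_poly f by blast
  obtain k where k: "k \<in> homog Rg" "smult k g \<in> polys_over R" using common_denominator_poly g by blast
  define F where "F = smult h f"
  define G where "G = smult k g"
  have FG: "F \<in> polys_over R" "G \<in> polys_over R" "F \<noteq> 0" "G \<noteq> 0"
    using h k f g homog_nz by (auto simp: F_def G_def)
  have FG_eq: "F * G = smult (h * k) (f * g)" by (simp add: F_def G_def mult.commute)
  have FGR: "F * G \<in> polys_over R" using FG subring_mult[OF is_subring_polys_over[OF R_subring]] by blast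
  have "x \<in> colon R (mprod R (Af R Rg f) (Af R Rg g)) \<longleftrightarrow>
      x / (h * k) \<in> colon R (mprod R (Af R Rg F) (Af R Rg G))"
    using colon_mprod_Af_iff[OF h(2,1) k(2,1)] colon_mprod_Af_iff[of 1 F 1 G] FG homog_1
    by (simp add: F_def G_def)
  also have "\<dots> \<longleftrightarrow> x / (h * k) \<in> colon R (Af R Rg (F * G))" using hyp FG by simp
  also have "\<dots> \<longleftrightarrow> (\<forall>i \<alpha>. x * (comp Rg (coeff (F * G) i) \<alpha> / (h * k)) \<in> R)"
    using colon_Af_iff[of 1 "F * G"] FGR homog_1 by simp
  also have "\<dots> \<longleftrightarrow> x \<in> colon R (Af R Rg (f * g))"
    using colon_Af_iff[of "h * k" "f * g"] FGR h k homog_mult unfolding FG_eq by simp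
  finally show "x \<in> colon R (mprod R (Af R Rg f) (Af R Rg g)) \<longleftrightarrow> x \<in> colon R (Af R Rg (f * g))" .
qed

lemma is_submodule_Af: "is_submodule R (Af R Rg f)"
  unfolding Af_def by (rule is_submodule_rmod[OF R_subring])

lemma comp_in_Af:
  assumes "coeff f i = r / h" "r \<in> R" "h \<in> homog Rg"
  shows "comp Rg r \<alpha> / h \<in> Af R Rg f"
proof (cases "i \<le> degree f")
  case True
  then show ?thesis
    unfolding Af_def using compsH_memI[OF assms(2,3), of \<alpha>] assms(1)
    by (intro subsetD[OF rmod_incl[OF R_subring]] UN_I[of i]) auto
next
  case False
  then have "r = 0" using assms homog_nz by (auto simp: coeff_eq_0)
  then show ?thesis using submodule_0[OF is_submodule_Af] by simp
qed

lemma coeff_in_Af: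
  assumes "coeff f i \<in> RH R Rg"
  shows "coeff f i \<in> Af R Rg f"
proof -
  obtain r h where r: "r \<in> R" "h \<in> homog Rg" "coeff f i = r / h" using RHE assms by blast
  have "coeff f i = (\<Sum>\<alpha> | comp Rg r \<alpha> \<noteq> 0. comp Rg r \<alpha>) / h" using sum_comp[OF r(1)] r(3) by simp
  also have "\<dots> = (\<Sum>\<alpha> | comp Rg r \<alpha> \<noteq> 0. comp Rg r \<alpha> / h)" by (rule sum_divide_distrib)
  also have "\<dots> \<in> Af R Rg f" using comp_in_Af[OF r(3,1,2)] by (intro submodule_sum[OF is_submodule_Af])
  finally show ?thesis .
qed

lemma Af_subset_R:
  assumes f: "f \<in> polys_over R"
  shows "Af R Rg f \<subseteq> R"
proof -
  have "1 \<in> colon R (Af R Rg f)"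
    using colon_Af_iff[of 1 f 1] f homog_1 Rg_R[OF comp_in[OF coeff_in[OF f]]] by simp
  then show ?thesis by (auto simp: colon_def)
qed

lemma Af_monic:
  assumes p: "p \<in> polys_over R" "lead_coeff p = 1"
  shows "Af R Rg p = R"
proof
  have "1 \<in> Af R Rg p"
    using coeff_in_Af[of p "degree p"] p RH_incl subring_1[OF R_subring] by auto
  then show "R \<subseteq> Af R Rg p" using submodule_scale[OF is_submodule_Af, of _ 1 p] by auto
qed (rule Af_subset_R[OF p(1)])

text \<open>A nonzero component \<open>e\<close> of the leading coefficient lies in the content, so
  \<open>y * e\<close> is in \<open>R\<close> and \<open>e\<close> is a homogeneous denominator of
  \<open>y\<close>.\<close>

lemma colon_Af_RH:
  assumes f: "f \<in> polys_over R" "f \<noteq> 0"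
  shows "colon R (Af R Rg f) \<subseteq> RH R Rg"
proof
  fix y assume y: "y \<in> colon R (Af R Rg f)"
  have c: "lead_coeff f \<in> R" using f by (simp add: coeff_in)
  then obtain \<alpha> where \<alpha>: "comp Rg (lead_coeff f) \<alpha> \<noteq> 0" using eq_0_if_comp[OF c] f by auto
  define e where "e = comp Rg (lead_coeff f) \<alpha>"
  have e: "e \<in> homog Rg" using homogI[OF comp_in[OF c]] \<alpha> by (auto simp: e_def)
  have "e \<in> Af R Rg f" using comp_in_Af[of f "degree f" "lead_coeff f" 1] c homog_1 by (simp add: e_def)
  then have "y * e \<in> R" using y by (simp add: colon_def)
  then have "(y * e) / e \<in> RH R Rg" using e by (rule RHI)
  then show "y \<in> RH R Rg" using homog_nz[OF e] by simp
qed

text \<open>An integral element lies in \<open>R\<^sub>H\<close>, so its equation of integral dependence has a linear factor over \<open>R\<^sub>H\<close>.\<close>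

lemma integral_elementE:
  assumes p: "lead_coeff p = 1" "\<forall>i. coeff p i \<in> R" "poly p x = 0"
  obtains g where "x \<in> RH R Rg" "p \<in> polys_over R" "p = [:- x, 1:] * g" "g \<in> polys_over (RH R Rg)"
    "lead_coeff g = 1"
proof -
  have pR: "p \<in> polys_over R" using p by (simp add: polys_over_def)
  then have x: "x \<in> RH R Rg" using integral_imp_RH p by blast
  obtain g where g: "p = [:- x, 1:] * g" using p(3) by (auto simp: poly_eq_0_iff_dvd elim: dvdE)
  have "g \<in> polys_over (RH R Rg)"
    using linear_factor_cofactor[OF is_subring_RH x, of g] pR polys_over_mono[OF RH_incl] g by auto
  moreover have "lead_coeff g = 1" using p(1) unfolding g lead_coeff_mult by simp
  ultimately show ?thesis using that x pR g by blast
qed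

text \<open>Both factors of \<open>p\<close> are monic, so both contents contain \<open>1\<close>,
  and that of the linear factor contains \<open>x\<close>. Thus \<open>x\<close> is in the product
  of the contents, whose closure is that of the content of \<open>p\<close>, namely
  \<open>R\<close>.\<close>

lemma integrally_closed_if_star:
  assumes st: "semi_star R st"
    and eq: "\<And>f g. f \<in> polys_over (RH R Rg) \<Longrightarrow> g \<in> polys_over (RH R Rg) \<Longrightarrow> f \<noteq> 0 \<Longrightarrow> g \<noteq> 0 \<Longrightarrow>
      degree f = 1 \<Longrightarrow> st (mprod R (Af R Rg f) (Af R Rg g)) = st (Af R Rg (f * g))"
  shows "integrally_closed R"
  unfolding integrally_closed_def
proof (intro allI impI, elim exE conjE)
  fix x p assume "lead_coeff p = 1" "\<forall>i. coeff p i \<in> R" "poly p x = 0"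
  then obtain g where x: "x \<in> RH R Rg" and p: "p \<in> polys_over R" "p = [:- x, 1:] * g"
    and g: "g \<in> polys_over (RH R Rg)" "lead_coeff g = 1" and lc: "lead_coeff p = 1"
    using integral_elementE by metis
  define f where "f = [:- x, 1:]"
  have f: "f \<in> polys_over (RH R Rg)"
    unfolding f_def polys_over_def using x is_subring_RH
    by (auto simp: coeff_pCons subring_0 subring_1 subring_uminus split: nat.split)
  define E where "E = mprod R (Af R Rg f) (Af R Rg g)"
  have "coeff f 0 \<in> Af R Rg f" "coeff f 1 \<in> Af R Rg f"
    using coeff_in_Af coeff_in[OF f] by blast+
  then have xf: "x \<in> Af R Rg f" "1 \<in> Af R Rg f"
    using submodule_uminus[OF R_subring is_submodule_Af, of "- x" f] by (auto simp: f_def)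
  have "lead_coeff g \<in> Af R Rg g" using coeff_in_Af coeff_in[OF g(1)] by blast
  then have 1: "1 \<in> Af R Rg g" using g by simp
  have inE: "a * b \<in> E" if "a \<in> Af R Rg f" "b \<in> Af R Rg g" for a b
    unfolding E_def mprod_def using that by (intro subsetD[OF rmod_incl[OF R_subring]]) blast
  have "x \<in> E" "1 \<in> E" using inE[OF xf(1) 1] inE[OF xf(2) 1] by simp_all
  moreover have "is_submodule R E" unfolding E_def mprod_def by (rule is_submodule_rmod[OF R_subring])
  ultimately have "x \<in> st E" using st by (auto simp: semi_star_def semistar_def nz_submod_iff)
  also have "st E = st (Af R Rg p)"
    unfolding E_def p(2) f_def[symmetric] using f g by (intro eq) (auto simp: f_def)
  also have "\<dots> = R" using st Af_monic[OF p(1) lc] by (simp add: semi_star_def)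
  finally show "x \<in> R" .
qed

text \<open>If \<open>f * h\<close> has coefficients in \<open>R\<close>, then \<open>1\<close> is
  in the colon of its content, hence in the colon of the product of the contents of \<open>f\<close>
  and \<open>h\<close>; so every coefficient of \<open>h\<close> multiplies the content of
  \<open>f\<close> into \<open>R\<close>.\<close>

lemma principal_contraction:
  assumes ic: "integrally_closed R" and f: "f \<in> polys_over R" "f \<noteq> 0"
  shows "{f * h | h. h \<in> polys_over (RH R Rg)} \<inter> polys_over R = {f * h | h. h \<in> polys_over (colon R (Af R Rg f))}"
    (is "?L = ?M")
proof
  have fRH: "f \<in> polys_over (RH R Rg)" using f polys_over_mono[OF RH_incl] by blast
  show "?L \<subseteq> ?M"
  proof
    fix p assume "p \<in> ?L"
    then obtain h where h: "h \<in> polys_over (RH R Rg)" "p = f * h" "f * h \<in> polys_over R" by blast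
    have "coeff h j \<in> colon R (Af R Rg f)" for j
    proof (cases "h = 0")
      case True
      then show ?thesis using submodule_0[OF is_submodule_colon[OF R_subring]] by simp
    next
      case False
      have "1 \<in> colon R (Af R Rg (f * h))" using Af_subset_R[OF h(3)] by (auto simp: colon_def)
      then have "1 \<in> colon R (mprod R (Af R Rg f) (Af R Rg h))"
        using colon_Af_mult_RH[OF colon_Af_mult[OF ic] fRH f(2) h(1) False] by blast
      then have "a * b \<in> R" if "a \<in> Af R Rg f" "b \<in> Af R Rg h" for a b
        using that by (simp add: colon_mprod[OF R_subring])
      moreover have "coeff h j \<in> Af R Rg h" using coeff_in_Af coeff_in[OF h(1)] by blast
      ultimately show ?thesis by (auto simp: colon_def mult.commute)
    qed
    then have "h \<in> polys_over (colon R (Af R Rg f))" by (simp add: polys_over_def)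
    then show "p \<in> ?M" using h(2) by blast
  qed
  show "?M \<subseteq> ?L"
  proof
    fix p assume "p \<in> ?M"
    then obtain h where h: "h \<in> polys_over (colon R (Af R Rg f))" "p = f * h" by blast
    have "coeff f i * coeff h j \<in> R" for i j
      using coeff_in[OF h(1), of j] coeff_in_Af[of f i] coeff_in[OF fRH, of i]
      by (auto simp: colon_def mult.commute)
    then have "p \<in> polys_over R"
      unfolding h(2) polys_over_def by (auto simp: coeff_mult intro!: subring_sum[OF R_subring])
    then show "p \<in> ?L" using h colon_Af_RH[OF f] polys_over_mono by blast
  qed
qed

lemma integrally_closed_if_contraction:
  assumes eq: "\<And>f. f \<in> polys_over R \<Longrightarrow> f \<noteq> 0 \<Longrightarrow>
     {f * h | h. h \<in> polys_over (RH R Rg)} \<inter> polys_over R = {f * h | h. h \<in> polys_over (colon R (Af R Rg f))}"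
  shows "integrally_closed R"
  unfolding integrally_closed_def
proof (intro allI impI, elim exE conjE)
  fix x p assume "lead_coeff p = 1" "\<forall>i. coeff p i \<in> R" "poly p x = 0"
  then obtain g where x: "x \<in> RH R Rg" and p: "p \<in> polys_over R" "p = [:- x, 1:] * g"
    and g: "g \<in> polys_over (RH R Rg)" "lead_coeff g = 1"
    using integral_elementE by metis
  obtain r h where r: "r \<in> R" "h \<in> homog Rg" "x = r / h" using RHE x by blast
  have h: "h \<in> R" "h \<noteq> 0" using r homog_R homog_nz by auto
  \<comment> \<open>Condition (4) concerns polynomials over \<open>R\<close>, so the linear factor
    is multiplied by the denominator of \<open>x\<close>. The cofactor then has leading coefficient
    \<open>1 / h\<close>, which (4) puts into the colon of a content containing \<open>- r\<close>;
    their product is \<open>- x\<close>.\<close>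
  define f where "f = [:- r, h:]"
  have f: "f \<in> polys_over R" "f \<noteq> 0"
    unfolding f_def polys_over_def using r h R_subring
    by (auto simp: coeff_pCons subring_0 subring_uminus split: nat.split)
  have f_eq: "f = smult h [:- x, 1:]" using h by (simp add: f_def r)
  have "f * smult (1 / h) g = smult (1 / h * h) ([:- x, 1:] * g)"
    unfolding f_eq by (simp only: mult_smult_left mult_smult_right smult_smult)
  then have pf: "p = f * smult (1 / h) g" using h(2) unfolding p(2) by (simp del: mult_pCons_left)
  have "1 / h \<in> RH R Rg" using RHI[OF subring_1[OF R_subring] r(2)] .
  then have "smult (1 / h) g \<in> polys_over (RH R Rg)"
    by (intro smult_in_polys_over is_subring_RH g)
  then have "p \<in> {f * h | h. h \<in> polys_over (RH R Rg)} \<inter> polys_over R" using pf p(1) by blast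
  then obtain q where q: "q \<in> polys_over (colon R (Af R Rg f))" "p = f * q" unfolding eq[OF f] by blast
  then have "f * q = f * smult (1 / h) g" using pf by (simp only:)
  then have "q = smult (1 / h) g" using f(2) by (metis mult_left_cancel)
  then have "lead_coeff q = 1 / h" using g by simp
  then have "1 / h \<in> colon R (Af R Rg f)" using coeff_in[OF q(1), of "degree q"] by simp
  moreover have "coeff f 0 \<in> Af R Rg f"
    using coeff_in_Af coeff_in[OF f(1), of 0] RH_incl by blast
  ultimately have "(1 / h) * (- r) \<in> R" by (auto simp: colon_def f_def)
  then have "- x \<in> R" by (simp add: r)
  then show "x \<in> R" using subring_uminus[OF R_subring, of "- x"] by simp
qed

end

theorem theorem3p3:
  fixes R :: "'k::field set" and Rg :: "'g::cancel_comm_monoid_add \<Rightarrow> 'k set"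
  assumes "torsion_free_quotient TYPE('g)"
    and "graded_domain R Rg"
  defines "P1 \<equiv> integrally_closed R"
    and "P2 \<equiv> (\<forall>f g. f \<in> polys_over R \<longrightarrow> g \<in> polys_over R \<longrightarrow> f \<noteq> 0 \<longrightarrow> g \<noteq> 0 \<longrightarrow>
                 vclos R (mprod R (Af R Rg f) (Af R Rg g)) = vclos R (Af R Rg (f * g)))"
    and "P3 \<equiv> (\<exists>st. semi_star R st \<and>
                 (\<forall>f g. f \<in> polys_over (RH R Rg) \<longrightarrow> g \<in> polys_over (RH R Rg) \<longrightarrow>
                    f \<noteq> 0 \<longrightarrow> g \<noteq> 0 \<longrightarrow> degree f = 1 \<longrightarrow>
                    st (mprod R (Af R Rg f) (Af R Rg g)) = st (Af R Rg (f * g))))"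
    and "P4 \<equiv> (\<forall>f. f \<in> polys_over R \<longrightarrow> f \<noteq> 0 \<longrightarrow>
                 {f * h | h. h \<in> polys_over (RH R Rg)} \<inter> polys_over R
                   = {f * h | h. h \<in> ext_mod R (colon R (Af R Rg f))})"
  shows "(P1 \<longleftrightarrow> P2) \<and> (P1 \<longleftrightarrow> P3) \<and> (P1 \<longleftrightarrow> P4)"
proof -
  interpret torsionless_graded_domain R Rg
    using assms(1,2) by unfold_locales
  have P12: "P1 \<Longrightarrow> P2"
    unfolding P1_def P2_def vclos_def using colon_Af_mult by simp
  have P23: "P3" if P2: "P2"
  proof -
    \<comment> \<open>Taking the colon once more recovers equality of colon modules from equality of
      v-closures; only in that form is it transferred from \<open>R\<close> to R_H.\<close>
    have *: "colon R (mprod R (Af R Rg f) (Af R Rg g)) = colon R (Af R Rg (f * g))"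
      if "f \<in> polys_over R" "g \<in> polys_over R" "f \<noteq> 0" "g \<noteq> 0" for f g
    proof -
      have "colon R (vclos R (mprod R (Af R Rg f) (Af R Rg g))) = colon R (vclos R (Af R Rg (f * g)))"
        using P2 that unfolding P2_def by simp
      then show ?thesis unfolding vclos_def colon_colon_colon .
    qed
    then show ?thesis
      unfolding P3_def using semi_star_vclos[OF R_subring] colon_Af_mult_RH[OF *]
      by (intro exI[of _ "vclos R"]) (simp add: vclos_def)
  qed
  have P31: "P3 \<Longrightarrow> P1"
    unfolding P1_def P3_def using integrally_closed_if_star by blast
  have P4: "P4 \<longleftrightarrow> (\<forall>f. f \<in> polys_over R \<longrightarrow> f \<noteq> 0 \<longrightarrow>
      {f * h | h. h \<in> polys_over (RH R Rg)} \<inter> polys_over R = {f * h | h. h \<in> polys_over (colon R (Af R Rg f))})"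
    unfolding P4_def by (simp add: ext_mod_eq_polys_over[OF R_subring is_submodule_colon[OF R_subring]])
  have P14: "P1 \<Longrightarrow> P4"
    unfolding P4 P1_def using principal_contraction by simp
  have P41: "P4 \<Longrightarrow> P1"
    unfolding P4 P1_def by (intro integrally_closed_if_contraction) simp
  show ?thesis using P12 P23 P31 P14 P41 by blast
qed

end
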